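(* Let $A(\varepsilon)=A+\varepsilon\tilde A$, where $\tilde A\mathbf 1=0$ and $A(\varepsilon)$ is an irreducible infinitesimal generator for all $\varepsilon$ in a sufficiently small neighbourhood of $0$. Let $\Psi(\varepsilon)$ be the matrix of first return probabilities to the initial level from above for the fluid model with phase generator $A(\varepsilon)$ and (unperturbed) rate matrix $C$, that is, the minimal nonnegative solution of $$C_{+}^{-1}Q_{+-}(\varepsilon)+C_{+}^{-1}Q_{++}(\varepsilon)X+X|C_{-}^{-1}|Q_{--}(\varepsilon)+X|C_{-}^{-1}|Q_{-+}(\varepsilon)X=0 .$$ Then $\Psi(\varepsilon)$ is analytic in a neighbourhood of $\varepsilon=0$. Furthermore, $\Psi^{(1)}=\frac{\mathrm d\Psi(\varepsilon)}{\mathrm d\varepsilon}\big|_{\varepsilon=0}$ is the unique solution $X$ of the Sylvester equation $$KX+XU=-C_+^{-1}\tilde Q_{+-}-C_+^{-1}\tilde Q_{++}\Psi-\Psi|C_-^{-1}|\tilde Q_{--}-\Psi|C_-^{-1}|\tilde Q_{-+}\Psi .$$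
   Context: Markov modulated fluid model: $\varphi(t)$ is a continuous-time Markov chain (the phase process) on a finite set $\mathcal S$ with generator $A$, and $Y(t)=Y(0)+\int_0^t c_{\varphi(s)}\,\mathrm ds$ with real rates $c_i$, $i\in\mathcal S$. Partition $\mathcal S=\mathcal S_+\cup\mathcal S_0\cup\mathcal S_-$ according to $c_i>0$, $c_i=0$, $c_i<0$; matrices indexed by phases are partitioned accordingly into blocks $A_{++},A_{+0},A_{+-}$, etc. Put $C_+=\mathrm{diag}(c_i:i\in\mathcal S_+)$, $C_-=\mathrm{diag}(c_i:i\in\mathcal S_-)$, and let $C$ be the block-diagonal matrix with diagonal blocks $C_+,0,C_-$; $|\cdot|$ denotes entrywise absolute value and $\mathbf 1$ is the column vector of ones. Standing assumption (positive recurrence): $\boldsymbol\xi C\mathbf 1<0$, where $\boldsymbol\xi$ is the stationary probability vector of the phase process, the unique solution of $\boldsymbol\xi A=0$, $\boldsymbol\xi\mathbf 1=1$. First return probabilities: for $i\in\mathcal S_+$, $j\in\mathcal S_-$, $\Psi_{ij}=\mathbb P[\tau_-<\infty,\ \varphi(\tau_-)=j\mid Y(0)=0,\varphi(0)=i]$ with $\tau_-=\inf\{t>0:Y(t)<0\}$. Define $$\begin{bmatrix}Q_{++}&Q_{+-}\\ Q_{-+}&Q_{--}\end{bmatrix}=\begin{bmatrix}A_{++}&A_{+-}\\ A_{-+}&A_{--}\end{bmatrix}+\begin{bmatrix}A_{+0}\\ A_{-0}\end{bmatrix}(-A_{00}^{-1})\begin{bmatrix}A_{0+}&A_{0-}\end{bmatrix}.$$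 It is known (Rogers) that $\Psi$ is the minimal nonnegative solution of $C_+^{-1}Q_{+-}+C_+^{-1}Q_{++}X+X|C_-^{-1}|Q_{--}+X|C_-^{-1}|Q_{-+}X=0$. Define $$U=|C_-^{-1}|Q_{--}+|C_-^{-1}|Q_{-+}\Psi,\qquad K=C_+^{-1}Q_{++}+\Psi|C_-^{-1}|Q_{-+}.$$ $Q(\varepsilon)$ is defined by the same formula as $Q$, with every block of $A$ replaced by the corresponding block of $A(\varepsilon)$. The matrix $\tilde Q$ is the first-order coefficient of $Q(\varepsilon)$: $Q(\varepsilon)=Q+\varepsilon\tilde Q+O(\varepsilon^2)$, with blocks $\tilde Q_{++},\tilde Q_{+-},\tilde Q_{-+},\tilde Q_{--}$. *)

theory Defs
  imports "HOL-Analysis.Analysis" "HOL-Library.Landau_Symbols"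
begin

text \<open>
  The phase space is the finite type \<open>'s\<close> and the rates form a vector \<open>c\<close>. Any of the sets
  of up, zero and down phases may be empty, so a block with rows in \<open>I\<close> and columns in \<open>J\<close> is
  not given a type of its own: it is a matrix over the full phase space that vanishes outside
  \<open>I \<times> J\<close>. With this convention \<open>**\<close>, \<open>+\<close> and the entrywise order \<open>\<le>\<close> on blocks of matching
  shapes agree with the operations on the blocks themselves.
\<close>

definition up_phases :: "real^'s \<Rightarrow> 's set" where
  "up_phases c = {i. c $ i > 0}"

definition zero_phases :: "real^'s \<Rightarrow> 's set" where
  "zero_phases c = {i. c $ i = 0}"

definition down_phases :: "real^'s \<Rightarrow> 's set" where
  "down_phases c = {i. c $ i < 0}"

definition block :: "'s set \<Rightarrow> 's set \<Rightarrow> real^'s^'s \<Rightarrow> real^'s^'s" where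
  "block I J M = (\<chi> i j. if i \<in> I \<and> j \<in> J then M $ i $ j else 0)"

definition block_shape :: "'s set \<Rightarrow> 's set \<Rightarrow> (real^'s^'s) set" where
  "block_shape I J = {M. \<forall>i j. \<not> (i \<in> I \<and> j \<in> J) \<longrightarrow> M $ i $ j = 0}"

text \<open>The identity of the square blocks on \<open>I\<close> is \<open>block I I (mat 1)\<close>.\<close>

definition block_inv :: "'s::finite set \<Rightarrow> real^'s^'s \<Rightarrow> real^'s^'s" where
  "block_inv I M = (THE N. N \<in> block_shape I I \<and>
     M ** N = block I I (mat 1) \<and> N ** M = block I I (mat 1))"

definition rate_matrix :: "real^'s \<Rightarrow> real^'s^'s" where
  "rate_matrix c = (\<chi> i j. if i = j then c $ i else 0)"

definition abs_entries :: "real^'s^'s \<Rightarrow> real^'s^'s" where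
  "abs_entries M = (\<chi> i j. \<bar>M $ i $ j\<bar>)"

definition generator :: "real^'s^'s \<Rightarrow> bool" where
  "generator A \<longleftrightarrow> (\<forall>i j. i \<noteq> j \<longrightarrow> 0 \<le> A $ i $ j) \<and> A *v 1 = 0"

definition irreducible_matrix :: "real^'s^'s \<Rightarrow> bool" where
  "irreducible_matrix A \<longleftrightarrow> (\<forall>i j. (i, j) \<in> {(k, l). k \<noteq> l \<and> A $ k $ l \<noteq> 0}\<^sup>*)"

definition stationary_distribution :: "real^'s^'s \<Rightarrow> real^'s \<Rightarrow> bool" where
  "stationary_distribution A \<xi> \<longleftrightarrow> (\<forall>i. 0 \<le> \<xi> $ i) \<and> \<xi> v* A = 0 \<and> \<xi> \<bullet> 1 = 1"

text \<open>\<open>C\<^sub>+\<^sup>-\<^sup>1\<close> and \<open>|C\<^sub>-\<^sup>-\<^sup>1|\<close>.\<close>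

definition C_up_inv :: "real^'s \<Rightarrow> real^'s^'s" where
  "C_up_inv c = block_inv (up_phases c) (block (up_phases c) (up_phases c) (rate_matrix c))"

definition abs_C_down_inv :: "real^'s \<Rightarrow> real^'s^'s" where
  "abs_C_down_inv c =
     abs_entries (block_inv (down_phases c) (block (down_phases c) (down_phases c) (rate_matrix c)))"

definition fluid_Q :: "real^'s \<Rightarrow> real^'s^'s \<Rightarrow> real^'s^'s" where
  "fluid_Q c A =
     (let E = up_phases c \<union> down_phases c; Z = zero_phases c
      in block E E A + block E Z A ** (- block_inv Z (block Z Z A)) ** block Z E A)"

abbreviation block_uu :: "real^'s \<Rightarrow> real^'s^'s \<Rightarrow> real^'s^'s" where
  "block_uu c \<equiv> block (up_phases c) (up_phases c)"

abbreviation block_ud :: "real^'s \<Rightarrow> real^'s^'s \<Rightarrow> real^'s^'s" where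
  "block_ud c \<equiv> block (up_phases c) (down_phases c)"

abbreviation block_du :: "real^'s \<Rightarrow> real^'s^'s \<Rightarrow> real^'s^'s" where
  "block_du c \<equiv> block (down_phases c) (up_phases c)"

abbreviation block_dd :: "real^'s \<Rightarrow> real^'s^'s \<Rightarrow> real^'s^'s" where
  "block_dd c \<equiv> block (down_phases c) (down_phases c)"

text \<open>Nonnegative solutions of the Riccati equation for the fluid model with phase generator \<open>A\<close>.\<close>

definition riccati_solution :: "real^'s \<Rightarrow> real^'s^'s \<Rightarrow> real^'s^'s \<Rightarrow> bool" where
  "riccati_solution c A X \<longleftrightarrow>
     X \<in> block_shape (up_phases c) (down_phases c) \<and> 0 \<le> X \<and>
     C_up_inv c ** block_ud c (fluid_Q c A)
     + C_up_inv c ** block_uu c (fluid_Q c A) ** X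
     + X ** abs_C_down_inv c ** block_dd c (fluid_Q c A)
     + X ** abs_C_down_inv c ** block_du c (fluid_Q c A) ** X = 0"

text \<open>
  The matrix of first return probabilities to the initial level from above, as the minimal
  nonnegative solution. Minimal means least in the entrywise order, so there is at most one.
\<close>

definition fluid_Psi :: "real^'s \<Rightarrow> real^'s^'s \<Rightarrow> real^'s^'s" where
  "fluid_Psi c A = (THE X. riccati_solution c A X \<and> (\<forall>Y. riccati_solution c A Y \<longrightarrow> X \<le> Y))"

definition fluid_U :: "real^'s \<Rightarrow> real^'s^'s \<Rightarrow> real^'s^'s" where
  "fluid_U c A = abs_C_down_inv c ** block_dd c (fluid_Q c A)
     + abs_C_down_inv c ** block_du c (fluid_Q c A) ** fluid_Psi c A"

definition fluid_K :: "real^'s \<Rightarrow> real^'s^'s \<Rightarrow> real^'s^'s" where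
  "fluid_K c A = C_up_inv c ** block_uu c (fluid_Q c A)
     + fluid_Psi c A ** abs_C_down_inv c ** block_du c (fluid_Q c A)"

text \<open>First-order coefficient at \<open>\<epsilon> = 0\<close> of \<open>Q(\<epsilon>)\<close> for the generators \<open>A + \<epsilon> A'\<close>.\<close>

definition fluid_Q_tilde :: "real^'s \<Rightarrow> real^'s^'s \<Rightarrow> real^'s^'s \<Rightarrow> real^'s^'s" where
  "fluid_Q_tilde c A A' = (THE Q'.
     (\<lambda>\<epsilon>. norm (fluid_Q c (A + \<epsilon> *\<^sub>R A') - fluid_Q c A - \<epsilon> *\<^sub>R Q')) \<in> O[at 0](\<lambda>\<epsilon>. \<epsilon>\<^sup>2))"

definition real_analytic_at :: "(real \<Rightarrow> 'b::real_normed_vector) \<Rightarrow> real \<Rightarrow> bool" where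
  "real_analytic_at f x \<longleftrightarrow>
     (\<exists>a r. r > 0 \<and> (\<forall>y. \<bar>y - x\<bar> < r \<longrightarrow> (\<lambda>k. (y - x) ^ k *\<^sub>R a k) sums f y))"

end

theory Submission
  imports Defs "HOL-Complex_Analysis.Cauchy_Integral_Formula"
begin

text \<open>
  Dividing the rows of \<open>Q\<close> by \<open>|c\<^sub>i|\<close> gives a matrix \<open>T\<close> with nonnegative off-diagonal entries
  and row sums \<open>0\<close> on the up and down phases, and the Riccati equation reads \<open>F X = 0\<close> with
  \<open>F X = T\<^sub>+\<^sub>- + T\<^sub>+\<^sub>+ X + X T\<^sub>-\<^sub>- + X T\<^sub>-\<^sub>+ X\<close>. For a large constant \<open>d\<close> the map
  \<open>G X = X + F X / d\<close> is quadratic with nonnegative coefficients, its fixed points are the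
  solutions of the Riccati equation, and \<open>\<Psi>\<close> is its least nonnegative fixed point. The
  derivative of \<open>G\<close> at \<open>\<Psi>\<close> is \<open>Z \<mapsto> Z + (K Z + Z U) / d\<close>, so the Sylvester operator and the
  fixed-point problem are governed by one and the same nonnegative linear map \<open>P\<close>.

  Everything follows once \<open>P\<close> is subcritical, that is, \<open>P w < w\<close> for some \<open>w > 0\<close>. In the norm
  \<open>max |z\<^sub>p| / w\<^sub>p\<close> the map \<open>G\<close> is then a contraction near \<open>\<Psi>\<close>, and it remains one, on
  complex matrices, when the parameter \<open>\<epsilon>\<close> moves through a small complex disc. The iterates are
  holomorphic in \<open>\<epsilon>\<close> and converge uniformly, so their limit is holomorphic; for real \<open>\<epsilon>\<close> it is a
  nonnegative fixed point that is still subcritical, hence the least one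
  (\<open>holomorphic_fixpoint\<close>, \<open>subcritical_fixpoint_least\<close>, \<open>least_fixpoint_analytic\<close>). Thus
  \<open>\<Psi>(\<epsilon>)\<close> is analytic. Differentiating the Riccati equation shows that the derivative solves the
  Sylvester equation, and a solution \<open>Z\<close> of the homogeneous equation satisfies \<open>P Z = Z\<close>, which
  forces \<open>Z = 0\<close>.

  Subcriticality is where the negative drift enters. Solving the Poisson equation
  \<open>A h = c - (\<xi> \<bullet> c) 1\<close> and eliminating the zero phases gives \<open>h\<close> with \<open>T h > 1\<close> on the up phases
  and \<open>T h > - 1\<close> on the down phases. By convexity of \<open>exp\<close>, the functions
  \<open>g\<^sub>t = exp (t h)\<close> satisfy \<open>T g\<^sub>t > t g\<^sub>t\<close> and \<open>T g\<^sub>t > - t g\<^sub>t\<close> there. For a substochastic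
  solution \<open>X\<close> of the Riccati equation the vector \<open>k\<^sub>t = X g\<^sub>t - g\<^sub>t\<close> on the up phases therefore
  satisfies \<open>K k\<^sub>t < t k\<^sub>t\<close>. As \<open>K\<close> has nonnegative off-diagonal entries, \<open>k\<^sub>t\<close> is positive for
  large \<open>t\<close> and, by continuity, can never lose positivity while \<open>t\<close> decreases to \<open>0\<close>. In the
  limit \<open>X\<close> is stochastic and \<open>k = X h - h\<close> is a positive vector with \<open>K k < 0\<close>
  (\<open>K_stable\<close>). As \<open>U 1 \<le> 0\<close>, taking row sums in \<open>K Z + Z U \<ge> 0\<close> for \<open>Z \<ge> 0\<close> leaves only \<open>Z = 0\<close>,
  and by linear algebra this is equivalent to the existence of \<open>w\<close> (\<open>riccati_subcritical\<close>).
\<close>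


section \<open>Germs of real analytic functions\<close>

text \<open>
  Analyticity at \<open>0\<close> is expressed through a complex extension. Sums, products and quotients are
  then those of complex analysis, and one disc of holomorphy gives a power series at every real
  point of a neighbourhood, not only at \<open>0\<close>.
\<close>

definition analytic_germ :: "(real \<Rightarrow> real) \<Rightarrow> bool" where
  "analytic_germ u \<longleftrightarrow>
     (\<exists>f. f analytic_on {0} \<and> (\<forall>\<^sub>F e in nhds 0. f (complex_of_real e) = of_real (u e)))"

lemma analytic_germ_cong:
  assumes "analytic_germ u" "\<forall>\<^sub>F e in nhds 0. u e = v e"
  shows "analytic_germ v"
proof -
  obtain f where "f analytic_on {0}" "\<forall>\<^sub>F e in nhds 0. f (complex_of_real e) = of_real (u e)"
    using assms(1) by (auto simp: analytic_germ_def)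
  moreover from this(2) assms(2) have "\<forall>\<^sub>F e in nhds 0. f (complex_of_real e) = of_real (v e)"
    by eventually_elim simp
  ultimately show ?thesis by (auto simp: analytic_germ_def)
qed

lemma analytic_germ_const: "analytic_germ (\<lambda>e. k)"
  unfolding analytic_germ_def by (intro exI[of _ "\<lambda>z. of_real k"]) auto

lemma analytic_germ_ident: "analytic_germ (\<lambda>e. e)"
  unfolding analytic_germ_def by (intro exI[of _ "\<lambda>z. z"]) auto

lemma analytic_germ_binop:
  assumes "analytic_germ u" "analytic_germ v"
    and "\<And>f g. f analytic_on {0} \<Longrightarrow> g analytic_on {0} \<Longrightarrow> (\<lambda>z. F (f z) (g z)) analytic_on {0}"
    and "\<And>a b. F (complex_of_real a) (of_real b) = of_real (R a b)"
  shows "analytic_germ (\<lambda>e. R (u e) (v e))"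
proof -
  obtain f where f: "f analytic_on {0}" "\<forall>\<^sub>F e in nhds 0. f (complex_of_real e) = of_real (u e)"
    using assms(1) by (auto simp: analytic_germ_def)
  obtain g where g: "g analytic_on {0}" "\<forall>\<^sub>F e in nhds 0. g (complex_of_real e) = of_real (v e)"
    using assms(2) by (auto simp: analytic_germ_def)
  have "\<forall>\<^sub>F e in nhds 0. F (f (complex_of_real e)) (g (complex_of_real e)) = of_real (R (u e) (v e))"
    using f(2) g(2) by eventually_elim (simp add: assms(4))
  with assms(3)[OF f(1) g(1)] show ?thesis by (auto simp: analytic_germ_def intro!: exI)
qed

lemma analytic_germ_add: "analytic_germ u \<Longrightarrow> analytic_germ v \<Longrightarrow> analytic_germ (\<lambda>e. u e + v e)"
  by (rule analytic_germ_binop[where F = "(+)"]) (auto intro!: analytic_intros)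

lemma analytic_germ_mult: "analytic_germ u \<Longrightarrow> analytic_germ v \<Longrightarrow> analytic_germ (\<lambda>e. u e * v e)"
  by (rule analytic_germ_binop[where F = "(*)"]) (auto intro!: analytic_intros)

lemma analytic_germ_divide:
  assumes "analytic_germ u" "analytic_germ v" "v 0 \<noteq> 0"
  shows "analytic_germ (\<lambda>e. u e / v e)"
proof -
  obtain f where f: "f analytic_on {0}" "\<forall>\<^sub>F e in nhds 0. f (complex_of_real e) = of_real (u e)"
    using assms(1) by (auto simp: analytic_germ_def)
  obtain g where g: "g analytic_on {0}" "\<forall>\<^sub>F e in nhds 0. g (complex_of_real e) = of_real (v e)"
    using assms(2) by (auto simp: analytic_germ_def)
  have "g 0 \<noteq> 0" using eventually_nhds_x_imp_x[OF g(2)] assms(3) by simp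
  then have "(\<lambda>z. f z / g z) analytic_on {0}" using f(1) g(1) by (intro analytic_intros) auto
  moreover have "\<forall>\<^sub>F e in nhds 0. f (complex_of_real e) / g (complex_of_real e) = of_real (u e / v e)"
    using f(2) g(2) by eventually_elim simp
  ultimately show ?thesis by (auto simp: analytic_germ_def intro!: exI)
qed

lemma analytic_germ_sum: "(\<And>i. i \<in> I \<Longrightarrow> analytic_germ (u i)) \<Longrightarrow> analytic_germ (\<lambda>e. \<Sum>i\<in>I. u i e)"
  by (induction I rule: infinite_finite_induct) (auto intro: analytic_germ_const analytic_germ_add)

lemma analytic_germ_prod: "(\<And>i. i \<in> I \<Longrightarrow> analytic_germ (u i)) \<Longrightarrow> analytic_germ (\<lambda>e. \<Prod>i\<in>I. u i e)"
  by (induction I rule: infinite_finite_induct) (auto intro: analytic_germ_const analytic_germ_mult)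

lemma analytic_germ_det:
  "(\<And>i j. analytic_germ (\<lambda>e. M e $ i $ j)) \<Longrightarrow> analytic_germ (\<lambda>e. det (M e))"
  unfolding det_def by (intro analytic_germ_sum analytic_germ_mult analytic_germ_const analytic_germ_prod)

text \<open>Finitely many germs extend to one common disc.\<close>

lemma analytic_germ_extension:
  fixes u :: "'i::finite \<Rightarrow> real \<Rightarrow> real"
  assumes "\<And>i. analytic_germ (u i)"
  obtains r f where "r > 0" "\<And>i. f i holomorphic_on ball 0 r"
    "\<And>i e. \<bar>e\<bar> < r \<Longrightarrow> f i (complex_of_real e) = of_real (u i e)"
proof -
  have "\<exists>f r. r > 0 \<and> f holomorphic_on ball 0 r \<and>
      (\<forall>e. \<bar>e\<bar> < r \<longrightarrow> f (complex_of_real e) = of_real (u i e))" for i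
  proof -
    obtain f where f: "f analytic_on {0}" "\<forall>\<^sub>F e in nhds 0. f (complex_of_real e) = of_real (u i e)"
      using assms[of i] by (auto simp: analytic_germ_def)
    obtain s where s: "s > 0" "f holomorphic_on ball 0 s" using f(1) by (auto simp: analytic_at_ball)
    obtain t where t: "t > 0" "\<And>e. \<bar>e\<bar> < t \<Longrightarrow> f (complex_of_real e) = of_real (u i e)"
      using f(2) by (auto simp: eventually_nhds_metric)
    show ?thesis
    proof (intro exI conjI allI impI)
      show "min s t > 0" using s t by simp
      show "f holomorphic_on ball 0 (min s t)" using s(2) by (rule holomorphic_on_subset) auto
    qed (use t in auto)
  qed
  then obtain f r where fr: "\<And>i. r i > 0" "\<And>i. f i holomorphic_on ball 0 (r i)"
    "\<And>i e. \<bar>e\<bar> < r i \<Longrightarrow> f i (complex_of_real e) = of_real (u i e)" by metis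
  define s where "s = Min (range r)"
  have s: "s > 0" "s \<le> r i" for i using fr(1) by (auto simp: s_def)
  show thesis
  proof (rule that[of s f])
    show "f i holomorphic_on ball 0 s" for i
      using fr(2) by (rule holomorphic_on_subset) (use s(2)[of i] in auto)
    show "f i (complex_of_real e) = of_real (u i e)" if "\<bar>e\<bar> < s" for i e
      using fr(3) s(2)[of i] that by simp
  qed (use s in auto)
qed

lemma analytic_germ_continuous:
  assumes "analytic_germ u" shows "(u \<longlongrightarrow> u 0) (nhds 0)"
proof -
  obtain f where f: "f analytic_on {0}" "\<forall>\<^sub>F e in nhds 0. f (complex_of_real e) = of_real (u e)"
    using assms by (auto simp: analytic_germ_def)
  have "isCont (\<lambda>e::real. Re (f (of_real e))) 0"
    using analytic_at_imp_isCont[OF f(1)] by (intro continuous_intros isCont_o2[where f = of_real]) auto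
  then have "((\<lambda>e::real. Re (f (of_real e))) \<longlongrightarrow> Re (f 0)) (nhds 0)"
    using tendsto_at_iff_tendsto_nhds[of "\<lambda>e::real. Re (f (of_real e))" 0] by (simp add: continuous_at)
  moreover have "\<forall>\<^sub>F e in nhds 0. Re (f (of_real e)) = u e"
    using f(2) by eventually_elim simp
  ultimately show ?thesis
    using eventually_nhds_x_imp_x[OF f(2)] by (simp add: tendsto_cong)
qed

text \<open>
  Splitting off a factor \<open>z\<close> twice from the holomorphic extension leaves a cofactor that is
  bounded near \<open>0\<close>.
\<close>

lemma analytic_germ_remainder:
  assumes "analytic_germ u"
  obtains d C where "\<forall>\<^sub>F e in nhds 0. \<bar>u e - u 0 - e * d\<bar> \<le> C * e\<^sup>2"
proof -
  obtain r f where r: "r > 0" and "\<And>i::unit. f i holomorphic_on ball 0 r"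
    and "\<And>(i::unit) e. \<bar>e\<bar> < r \<Longrightarrow> f i (complex_of_real e) = of_real (u e)"
    using analytic_germ_extension[of "\<lambda>_::unit. u"] assms by metis
  then have hol: "f () holomorphic_on ball 0 r"
    and fu: "\<And>e. \<bar>e\<bar> < r \<Longrightarrow> f () (complex_of_real e) = of_real (u e)" by auto
  have factor: "\<exists>h. h holomorphic_on ball 0 r \<and> (\<forall>z. g z = g 0 + z * h z)"
    if "g holomorphic_on ball 0 r" for g :: "complex \<Rightarrow> complex"
  proof -
    have "(\<lambda>z. if z = 0 then deriv g 0 else (g z - g 0) / (z - 0)) holomorphic_on ball 0 r"
      by (rule pole_lemma[OF that]) (use r in auto)
    then show ?thesis
      by (rule_tac exI, rule_tac conjI, assumption) auto
  qed
  obtain g where g: "g holomorphic_on ball 0 r" "\<And>z. f () z = f () 0 + z * g z"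
    using factor[OF hol] by auto
  obtain h where h: "h holomorphic_on ball 0 r" "\<And>z. g z = g 0 + z * h z"
    using factor[OF g(1)] by auto
  have "continuous_on (cball 0 (r/2)) h"
    by (intro holomorphic_on_imp_continuous_on holomorphic_on_subset[OF h(1)]) (use r in auto)
  then have "compact (h ` cball 0 (r/2))" by (intro compact_continuous_image) auto
  then obtain C where C: "\<And>z. z \<in> cball 0 (r/2) \<Longrightarrow> norm (h z) \<le> C"
    by (meson bounded_iff compact_imp_bounded imageI)
  have "\<bar>u e - u 0 - e * Re (g 0)\<bar> \<le> C * e\<^sup>2" if e: "\<bar>e\<bar> < r/2" for e
  proof -
    have "complex_of_real (u e) = of_real (u 0) + of_real e * (g 0 + of_real e * h (of_real e))"
      using g(2)[of "of_real e"] h(2)[of "of_real e"] fu[of e] fu[of 0] e r by simp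
    then have "Re (complex_of_real (u e)) = Re (of_real (u 0) + of_real e * (g 0 + of_real e * h (of_real e)))"
      by simp
    then have "u e - u 0 - e * Re (g 0) = e\<^sup>2 * Re (h (of_real e))"
      by (simp add: algebra_simps power2_eq_square)
    moreover have "\<bar>Re (h (of_real e))\<bar> \<le> C"
      using abs_Re_le_cmod[of "h (of_real e)"] C[of "of_real e"] e by simp
    ultimately show ?thesis by (simp add: abs_mult mult.commute[of C] mult_left_mono)
  qed
  then show thesis
    by (intro that[of "Re (g 0)" C]) (auto simp: eventually_nhds_metric intro!: exI[of _ "r/2"] r half_gt_zero)
qed

text \<open>
  The complex extension has a power series around each real point of the disc; the real parts of
  the coefficients give the real one.
\<close>

lemma real_analytic_at_matrix:
  fixes M :: "real \<Rightarrow> real^'m^'n"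
  assumes "\<And>i j. analytic_germ (\<lambda>e. M e $ i $ j)"
  shows "\<forall>\<^sub>F x in nhds 0. real_analytic_at M x"
proof -
  obtain r f where r: "r > 0" and hol: "\<And>p. f p holomorphic_on ball 0 r"
    and fM: "\<And>p e. \<bar>e\<bar> < r \<Longrightarrow> f p (complex_of_real e) = of_real (M e $ fst p $ snd p)"
    using analytic_germ_extension[of "\<lambda>p e. M e $ fst p $ snd p"] assms by metis
  have "real_analytic_at M x" if x: "\<bar>x\<bar> < r/2" for x
    unfolding real_analytic_at_def
  proof (intro exI conjI allI impI)
    show "r/2 > 0" using r by simp
    fix y assume y: "\<bar>y - x\<bar> < r/2"
    define a where "a p k = (deriv ^^ k) (f p) (of_real x) / fact k" for p k
    show "(\<lambda>k. (y - x) ^ k *\<^sub>R (\<chi> i j. Re (a (i,j) k))) sums M y"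
      unfolding sums_def
    proof (intro vec_tendstoI)
      fix i j
      have "f (i,j) holomorphic_on ball (of_real x) (r/2)"
      proof (rule holomorphic_on_subset[OF hol], rule subsetI)
        fix z assume "z \<in> ball (complex_of_real x) (r/2)"
        then have "norm (z - of_real x) < r/2" by (simp add: dist_norm norm_minus_commute)
        then show "z \<in> ball 0 r" using norm_triangle_ineq[of "z - of_real x" "of_real x"] x by simp
      qed
      then have "(\<lambda>k. a (i,j) k * (of_real y - of_real x) ^ k) sums f (i,j) (of_real y)"
        unfolding a_def by (rule holomorphic_power_series)
          (use y in \<open>simp add: dist_norm norm_minus_commute abs_minus_commute flip: of_real_diff\<close>)
      then have "(\<lambda>k. Re (a (i,j) k * (of_real y - of_real x) ^ k)) sums Re (f (i,j) (of_real y))"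
        by (rule sums_Re)
      moreover have "Re (f (i,j) (of_real y)) = M y $ i $ j" using x y by (subst fM) (auto simp: abs_if split: if_splits)
      moreover have "Re (a (i,j) k * (of_real y - of_real x) ^ k) = (y - x) ^ k * Re (a (i,j) k)" for k
        by (simp flip: of_real_diff of_real_power)
      ultimately have "(\<lambda>k. (y - x) ^ k * Re (a (i,j) k)) sums (M y $ i $ j)" by (simp only:)
      then show "(\<lambda>n. (\<Sum>k<n. (y - x) ^ k *\<^sub>R (\<chi> i j. Re (a (i,j) k))) $ i $ j) \<longlonglongrightarrow> M y $ i $ j"
        by (simp add: sums_def sum_component)
    qed
  qed
  then show ?thesis using r
    by (auto simp: eventually_nhds_metric intro!: exI[of _ "r/2"])
qed

lemma matrix_first_order_expansion:
  fixes M :: "real \<Rightarrow> real^'m^'n"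
  assumes "\<And>i j. analytic_germ (\<lambda>e. M e $ i $ j)"
  obtains D where "(\<lambda>e. norm (M e - M 0 - e *\<^sub>R D)) \<in> O[at 0](\<lambda>e. e\<^sup>2)"
proof -
  have "\<forall>i j. \<exists>d C. \<forall>\<^sub>F e in nhds 0. \<bar>M e $ i $ j - M 0 $ i $ j - e * d\<bar> \<le> C * e\<^sup>2"
    using analytic_germ_remainder[OF assms] by blast
  then obtain d C where
    dC: "\<forall>\<^sub>F e in nhds 0. \<bar>M e $ i $ j - M 0 $ i $ j - e * d i j\<bar> \<le> C i j * e\<^sup>2" for i j
    by (simp only: choice_iff) blast
  have "\<forall>\<^sub>F e in nhds 0. \<forall>i j. \<bar>M e $ i $ j - M 0 $ i $ j - e * d i j\<bar> \<le> C i j * e\<^sup>2"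
    by (intro eventually_all_finite dC)
  then have "\<forall>\<^sub>F e in nhds 0. norm (M e - M 0 - e *\<^sub>R (\<chi> i j. d i j)) \<le> (\<Sum>i\<in>UNIV. \<Sum>j\<in>UNIV. C i j) * norm (e\<^sup>2)"
  proof eventually_elim
    case (elim e)
    have "norm (M e - M 0 - e *\<^sub>R (\<chi> i j. d i j))
        \<le> (\<Sum>i\<in>UNIV. norm ((M e - M 0 - e *\<^sub>R (\<chi> i j. d i j)) $ i))"
      by (simp add: norm_vec_def L2_set_le_sum)
    also have "\<dots> \<le> (\<Sum>i\<in>UNIV. \<Sum>j\<in>UNIV. \<bar>(M e - M 0 - e *\<^sub>R (\<chi> i j. d i j)) $ i $ j\<bar>)"
      by (intro sum_mono norm_le_l1_cart)
    also have "\<dots> \<le> (\<Sum>i\<in>UNIV. \<Sum>j\<in>UNIV. C i j * e\<^sup>2)"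
      using elim by (intro sum_mono) simp
    finally show ?case by (simp add: sum_distrib_right)
  qed
  then have "\<forall>\<^sub>F e in at 0. norm (norm (M e - M 0 - e *\<^sub>R (\<chi> i j. d i j))) \<le> (\<Sum>i\<in>UNIV. \<Sum>j\<in>UNIV. C i j) * norm (e\<^sup>2)"
    by (simp add: eventually_nhds_conv_at)
  then show thesis by (intro that bigoI)
qed

lemma first_order_expansion_imp_has_vector_derivative:
  fixes f :: "real \<Rightarrow> 'a::real_normed_vector"
  assumes "(\<lambda>e. norm (f e - f 0 - e *\<^sub>R D)) \<in> O[at 0](\<lambda>e. e\<^sup>2)"
  shows "(f has_vector_derivative D) (at 0)"
proof -
  obtain C where C: "\<forall>\<^sub>F e in at 0. norm (f e - f 0 - e *\<^sub>R D) \<le> C * e\<^sup>2"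
    using landau_o.bigE[OF assms] by auto
  have *: "\<forall>\<^sub>F e in at 0. norm (norm (f e - f 0 - e *\<^sub>R D) / norm e) \<le> C * \<bar>e\<bar>"
    using C eventually_neq_at_within[of 0 0 UNIV]
  proof eventually_elim
    case (elim e)
    then have "norm (f e - f 0 - e *\<^sub>R D) \<le> C * \<bar>e\<bar> * \<bar>e\<bar>"
      by (simp add: power2_eq_square mult.assoc flip: abs_mult)
    then have "norm (f e - f 0 - e *\<^sub>R D) / \<bar>e\<bar> \<le> C * \<bar>e\<bar>"
      using elim(2) by (subst pos_divide_le_eq) auto
    then show ?case by simp
  qed
  have "((\<lambda>e. C * \<bar>e\<bar>) \<longlongrightarrow> C * \<bar>0\<bar>) (at (0::real))" by (intro tendsto_intros)
  then have "((\<lambda>e. C * \<bar>e\<bar>) \<longlongrightarrow> 0) (at (0::real))" by simp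
  then have "((\<lambda>e. norm (f e - f 0 - e *\<^sub>R D) / norm e) \<longlongrightarrow> 0) (at 0)"
    by (rule Lim_null_comparison[OF *])
  then show ?thesis
    unfolding has_vector_derivative_def has_derivative_at
    by (simp add: bounded_linear_scaleR_left)
qed

text \<open>
  A first-order coefficient is a derivative, so it is unique and the definite description in
  \<open>fluid_Q_tilde\<close> is meaningful.
\<close>

lemma fluid_Q_tilde_eqI:
  assumes "(\<lambda>e. norm (fluid_Q c (A + e *\<^sub>R A') - fluid_Q c A - e *\<^sub>R D)) \<in> O[at 0](\<lambda>e. e\<^sup>2)"
  shows "fluid_Q_tilde c A A' = D"
  unfolding fluid_Q_tilde_def
proof (rule the_equality)
  fix D' assume "(\<lambda>e. norm (fluid_Q c (A + e *\<^sub>R A') - fluid_Q c A - e *\<^sub>R D')) \<in> O[at 0](\<lambda>e. e\<^sup>2)"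
  then have "((\<lambda>e. fluid_Q c (A + e *\<^sub>R A')) has_vector_derivative D') (at 0)"
    by (intro first_order_expansion_imp_has_vector_derivative) simp
  moreover have "((\<lambda>e. fluid_Q c (A + e *\<^sub>R A')) has_vector_derivative D) (at 0)"
    using assms by (intro first_order_expansion_imp_has_vector_derivative) simp
  ultimately show "D' = D" by (rule vector_derivative_unique_at)
qed (use assms in simp)


section \<open>Quadratic maps with nonnegative coefficients\<close>

text \<open>
  At an index where \<open>x i / w i\<close> is maximal, \<open>x \<le> P x\<close> and \<open>P w < w\<close> contradict each other
  unless the maximum is \<open>0\<close>.
\<close>

lemma subharmonic_eq_0:
  fixes P :: "'i::finite \<Rightarrow> 'i \<Rightarrow> real"
  assumes P: "\<And>i j. 0 \<le> P i j" and w: "\<And>i. 0 < w i" "\<And>i. (\<Sum>j\<in>UNIV. P i j * w j) < w i"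
    and x: "\<And>i. 0 \<le> x i" "\<And>i. x i \<le> (\<Sum>j\<in>UNIV. P i j * x j)"
  shows "x i = 0"
proof -
  define t where "t = Max (range (\<lambda>i. x i / w i))"
  have "x j / w j \<le> t" for j by (simp add: t_def)
  then have le: "x j \<le> t * w j" for j using w(1)[of j] by (simp flip: pos_divide_le_eq)
  have "t \<in> range (\<lambda>i. x i / w i)" unfolding t_def by (intro Max_in) auto
  then obtain m where m: "t = x m / w m" by auto
  have "t \<le> 0"
  proof (rule ccontr)
    assume "\<not> t \<le> 0"
    then have t: "t > 0" by simp
    have "x m \<le> (\<Sum>j\<in>UNIV. P m j * x j)" by (rule x)
    also have "\<dots> \<le> (\<Sum>j\<in>UNIV. P m j * (t * w j))" by (intro sum_mono mult_left_mono le P)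
    also have "\<dots> = t * (\<Sum>j\<in>UNIV. P m j * w j)" by (simp add: sum_distrib_left mult_ac)
    also have "\<dots> < t * w m" using w(2) t by (intro mult_strict_left_mono) auto
    also have "\<dots> = x m" using m w(1)[of m] by simp
    finally show False by simp
  qed
  then have "t * w i \<le> 0" using w(1)[of i] by (simp add: mult_nonpos_nonneg)
  then show ?thesis using le[of i] x(1)[of i] by simp
qed

text \<open>
  Converse of \<open>subharmonic_eq_0\<close>: a nonnegative matrix without nonzero nonnegative vectors
  \<open>x \<le> P x\<close> has a strict positive supersolution, namely the solution of \<open>w = 1 + P w\<close>. It exists
  because the same hypothesis, applied to absolute values, makes \<open>1 - P\<close> injective.
\<close>

lemma strict_superharmonic_exists:
  fixes P :: "'i::finite \<Rightarrow> 'i \<Rightarrow> real"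
  assumes P: "\<And>i j. 0 \<le> P i j"
    and sub: "\<And>x. (\<And>i. 0 \<le> x i) \<Longrightarrow> (\<And>i. x i \<le> (\<Sum>j\<in>UNIV. P i j * x j)) \<Longrightarrow> \<forall>i. x i = 0"
  obtains w where "\<And>i. 0 < w i" "\<And>i. (\<Sum>j\<in>UNIV. P i j * w j) < w i"
proof -
  define M :: "real^'i^'i" where "M = mat 1 - (\<chi> i j. P i j)"
  have M: "(M *v x) $ i = x $ i - (\<Sum>j\<in>UNIV. P i j * x $ j)" for x i
    by (simp add: M_def matrix_vector_mult_diff_rdistrib) (simp add: matrix_vector_mult_def)
  have "inj ((*v) M)"
  proof (subst linear_injective_0[OF matrix_vector_mul_linear], intro allI impI)
    fix x assume "M *v x = 0"
    then have eq: "x $ i = (\<Sum>j\<in>UNIV. P i j * x $ j)" for i using M[of x i] by simp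
    have "\<bar>x $ i\<bar> \<le> (\<Sum>j\<in>UNIV. P i j * \<bar>x $ j\<bar>)" for i
    proof -
      have "\<bar>x $ i\<bar> \<le> (\<Sum>j\<in>UNIV. \<bar>P i j * x $ j\<bar>)" by (subst eq) (rule sum_abs)
      then show ?thesis by (simp add: abs_mult P)
    qed
    then have "\<forall>i. \<bar>x $ i\<bar> = 0" by (intro sub) auto
    then show "x = 0" by (simp add: vec_eq_iff)
  qed
  then have "surj ((*v) M)" by (intro linear_injective_imp_surjective) auto
  then obtain x where x: "M *v x = 1" by (metis surjD)
  have eq: "x $ i = 1 + (\<Sum>j\<in>UNIV. P i j * x $ j)" for i using M[of x i] x by simp
  \<comment> \<open>The negative part of the solution satisfies the inequality of the hypothesis.\<close>
  have "\<forall>i. max 0 (- x $ i) = 0"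
  proof (rule sub)
    fix i
    have "(\<Sum>j\<in>UNIV. P i j * (- x $ j)) \<le> (\<Sum>j\<in>UNIV. P i j * max 0 (- x $ j))"
      by (intro sum_mono mult_left_mono P) simp
    moreover have "0 \<le> (\<Sum>j\<in>UNIV. P i j * max 0 (- x $ j))" by (intro sum_nonneg mult_nonneg_nonneg P) simp
    ultimately show "max 0 (- x $ i) \<le> (\<Sum>j\<in>UNIV. P i j * max 0 (- x $ j))"
      using eq[of i] by (simp add: sum_negf)
  qed simp
  then have nn: "0 \<le> x $ i" for i by (metis max.cobounded2 neg_le_0_iff_le)
  show thesis
  proof (rule that[of "\<lambda>i. x $ i"])
    fix i
    have "0 \<le> (\<Sum>j\<in>UNIV. P i j * x $ j)" by (intro sum_nonneg mult_nonneg_nonneg P nn)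
    then show "0 < x $ i" "(\<Sum>j\<in>UNIV. P i j * x $ j) < x $ i" using eq[of i] by simp_all
  qed
qed

definition quad_map ::
  "('i::finite \<Rightarrow> 'a::comm_ring_1) \<Rightarrow> ('i \<Rightarrow> 'i \<Rightarrow> 'a) \<Rightarrow> ('i \<Rightarrow> 'i \<Rightarrow> 'i \<Rightarrow> 'a) \<Rightarrow> ('i \<Rightarrow> 'a) \<Rightarrow> 'i \<Rightarrow> 'a" where
  "quad_map a b c x i =
     a i + (\<Sum>j\<in>UNIV. b i j * x j) + (\<Sum>j\<in>UNIV. \<Sum>k\<in>UNIV. c i j k * x j * x k)"

text \<open>
  The divided difference of \<open>quad_map\<close>, a matrix of Jacobian type that depends affinely on both
  points; on the diagonal it is the Jacobian.
\<close>

definition quad_slope ::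
  "('i::finite \<Rightarrow> 'i \<Rightarrow> 'a::comm_ring_1) \<Rightarrow> ('i \<Rightarrow> 'i \<Rightarrow> 'i \<Rightarrow> 'a) \<Rightarrow> ('i \<Rightarrow> 'a) \<Rightarrow> ('i \<Rightarrow> 'a) \<Rightarrow> 'i \<Rightarrow> 'i \<Rightarrow> 'a" where
  "quad_slope b c x y i j = b i j + (\<Sum>k\<in>UNIV. c i j k * y k + c i k j * x k)"

lemma quad_map_diff:
  "quad_map a b c x i - quad_map a b c y i = (\<Sum>j\<in>UNIV. quad_slope b c x y i j * (x j - y j))"
proof -
  have "(\<Sum>j\<in>UNIV. \<Sum>k\<in>UNIV. c i j k * x j * x k) - (\<Sum>j\<in>UNIV. \<Sum>k\<in>UNIV. c i j k * y j * y k)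
      = (\<Sum>j\<in>UNIV. \<Sum>k\<in>UNIV. c i j k * y k * (x j - y j)) + (\<Sum>j\<in>UNIV. \<Sum>k\<in>UNIV. c i j k * x j * (x k - y k))"
    by (simp add: algebra_simps flip: sum.distrib sum_subtractf)
  also have "(\<Sum>j\<in>UNIV. \<Sum>k\<in>UNIV. c i j k * x j * (x k - y k)) = (\<Sum>j\<in>UNIV. \<Sum>k\<in>UNIV. c i k j * x k * (x j - y j))"
    by (rule sum.swap)
  finally show ?thesis
    by (simp add: quad_map_def quad_slope_def algebra_simps sum.distrib sum_subtractf sum_distrib_right sum_distrib_left)
qed

lemma quad_slope_nonneg:
  fixes b :: "'i::finite \<Rightarrow> 'i \<Rightarrow> real"
  assumes "\<And>i j. 0 \<le> b i j" "\<And>i j k. 0 \<le> c i j k" "\<And>i. 0 \<le> x i" "\<And>i. 0 \<le> y i"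
  shows "0 \<le> quad_slope b c x y i j"
  unfolding quad_slope_def by (intro add_nonneg_nonneg sum_nonneg mult_nonneg_nonneg assms)

lemma quad_slope_mono:
  fixes b :: "'i::finite \<Rightarrow> 'i \<Rightarrow> real"
  assumes "\<And>i j k. 0 \<le> c i j k" "\<And>i. x i \<le> x' i" "\<And>i. y i \<le> y' i"
  shows "quad_slope b c x y i j \<le> quad_slope b c x' y' i j"
  unfolding quad_slope_def by (intro add_mono order_refl sum_mono mult_left_mono assms)

lemma quad_map_mono:
  fixes b :: "'i::finite \<Rightarrow> 'i \<Rightarrow> real"
  assumes "\<And>i j. 0 \<le> b i j" "\<And>i j k. 0 \<le> c i j k" "\<And>i. 0 \<le> x i" "\<And>i. x i \<le> y i"
  shows "quad_map a b c x i \<le> quad_map a b c y i"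
proof -
  have "0 \<le> (\<Sum>j\<in>UNIV. quad_slope b c y x i j * (y j - x j))"
    using assms by (intro sum_nonneg mult_nonneg_nonneg quad_slope_nonneg) (auto intro: order_trans[OF assms(3,4)])
  then show ?thesis by (simp flip: quad_map_diff[of a])
qed

lemma quad_map_nonneg:
  fixes b :: "'i::finite \<Rightarrow> 'i \<Rightarrow> real"
  assumes "\<And>i. 0 \<le> a i" "\<And>i j. 0 \<le> b i j" "\<And>i j k. 0 \<le> c i j k" "\<And>i. 0 \<le> x i"
  shows "0 \<le> quad_map a b c x i"
  unfolding quad_map_def by (intro add_nonneg_nonneg sum_nonneg mult_nonneg_nonneg assms)

lemma tendsto_quad_map:
  fixes a :: "'i::finite \<Rightarrow> 'a::real_normed_field"
  assumes "\<And>i. ((\<lambda>n. X n i) \<longlongrightarrow> x i) F"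
  shows "((\<lambda>n. quad_map a b c (X n) i) \<longlongrightarrow> quad_map a b c x i) F"
  unfolding quad_map_def by (intro tendsto_intros assms)

definition least_fixpoint :: "('i::finite \<Rightarrow> real) \<Rightarrow> ('i \<Rightarrow> 'i \<Rightarrow> real) \<Rightarrow> ('i \<Rightarrow> 'i \<Rightarrow> 'i \<Rightarrow> real) \<Rightarrow> ('i \<Rightarrow> real) \<Rightarrow> bool" where
  "least_fixpoint a b c y \<longleftrightarrow> (\<forall>i. 0 \<le> y i) \<and> quad_map a b c y = y \<and>
     (\<forall>x. (\<forall>i. 0 \<le> x i) \<longrightarrow> quad_map a b c x = x \<longrightarrow> (\<forall>i. y i \<le> x i))"

text \<open>
  The iterates started at \<open>0\<close> increase and stay below every nonnegative fixed point, so a bound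
  on them is all that is needed. The limit statement lets properties of the iterates pass to the
  least fixed point.
\<close>

lemma quad_map_iterates_limit:
  fixes a :: "'i::finite \<Rightarrow> real"
  assumes nn: "\<And>i. 0 \<le> a i" "\<And>i j. 0 \<le> b i j" "\<And>i j k. 0 \<le> c i j k"
    and bdd: "\<And>n i. (quad_map a b c ^^ n) (\<lambda>_. 0) i \<le> u i"
  obtains y where "\<And>i. (\<lambda>n. (quad_map a b c ^^ n) (\<lambda>_. 0) i) \<longlonglongrightarrow> y i" "least_fixpoint a b c y"
proof -
  define X where "X n = (quad_map a b c ^^ n) (\<lambda>_. 0)" for n
  have X_Suc: "X (Suc n) = quad_map a b c (X n)" for n by (simp add: X_def)
  have X_nn: "0 \<le> X n i" for n i
    by (induction n arbitrary: i) (simp_all add: X_def quad_map_nonneg nn)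
  have mono: "X n i \<le> X (Suc n) i" for n i
  proof (induction n arbitrary: i)
    case 0
    then show ?case using X_nn[of "Suc 0" i] by (simp add: X_def)
  next
    case (Suc n)
    show ?case using quad_map_mono[OF nn(2,3) X_nn Suc] by (simp add: X_Suc)
  qed
  have "convergent (\<lambda>n. X n i)" for i
    unfolding convergent_def
  proof (rule incseq_convergent)
    show "incseq (\<lambda>n. X n i)" by (intro incseq_SucI mono)
    show "\<forall>n. X n i \<le> u i" using bdd by (simp add: X_def)
  qed blast
  define y where "y i = lim (\<lambda>n. X n i)" for i
  have y: "(\<lambda>n. X n i) \<longlonglongrightarrow> y i" for i
    unfolding y_def using \<open>convergent (\<lambda>n. X n i)\<close> by (simp add: convergent_LIMSEQ_iff)
  have "quad_map a b c y = y"
  proof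
    fix i
    have "(\<lambda>n. X (Suc n) i) \<longlonglongrightarrow> quad_map a b c y i"
      unfolding X_Suc by (rule tendsto_quad_map) (rule y)
    then show "quad_map a b c y i = y i" using LIMSEQ_Suc[OF y[of i]] by (rule LIMSEQ_unique)
  qed
  moreover have "y i \<le> x i" if "\<forall>i. 0 \<le> x i" "quad_map a b c x = x" for x i
  proof -
    have "X n i \<le> x i" for n i
    proof (induction n arbitrary: i)
      case (Suc n)
      then have "quad_map a b c (X n) i \<le> quad_map a b c x i" by (intro quad_map_mono nn X_nn)
      then show ?case using that by (simp add: X_Suc)
    qed (use that in \<open>simp add: X_def\<close>)
    then show ?thesis by (intro LIMSEQ_le_const2[OF y]) auto
  qed
  moreover have "0 \<le> y i" for i using X_nn by (intro LIMSEQ_le_const[OF y]) auto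
  ultimately have "least_fixpoint a b c y" by (simp add: least_fixpoint_def)
  with y show thesis by (intro that) (simp_all add: X_def)
qed

text \<open>
  The least fixed point \<open>z\<close> lies below \<open>y\<close>. The difference \<open>y - z\<close> is mapped to itself by the
  divided difference at \<open>(y, z)\<close>, hence is at most its image under the Jacobian at \<open>y\<close>, and so it
  vanishes.
\<close>

lemma subcritical_fixpoint_least:
  fixes a :: "'i::finite \<Rightarrow> real"
  assumes nn: "\<And>i. 0 \<le> a i" "\<And>i j. 0 \<le> b i j" "\<And>i j k. 0 \<le> c i j k"
    and y: "\<And>i. 0 \<le> y i" "quad_map a b c y = y"
    and w: "\<And>i. 0 < w i" "\<And>i. (\<Sum>j\<in>UNIV. quad_slope b c y y i j * w j) < w i"
  shows "least_fixpoint a b c y"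
proof -
  have nonneg: "0 \<le> (quad_map a b c ^^ n) (\<lambda>_. 0) i" for n i
    by (induction n arbitrary: i) (simp_all add: quad_map_nonneg nn)
  have "(quad_map a b c ^^ n) (\<lambda>_. 0) i \<le> y i" for n i
  proof (induction n arbitrary: i)
    case (Suc n)
    then have "quad_map a b c ((quad_map a b c ^^ n) (\<lambda>_. 0)) i \<le> quad_map a b c y i"
      by (intro quad_map_mono nn nonneg)
    then show ?case using y by simp
  qed (simp add: y)
  then obtain z where z: "least_fixpoint a b c z"
    by (rule quad_map_iterates_limit[of a b c y, OF nn])
  have z0: "0 \<le> z i" and zy: "z i \<le> y i" for i using z y unfolding least_fixpoint_def by auto
  have "y i - z i = 0" for i
  proof (rule subharmonic_eq_0[OF _ w])
    show "0 \<le> quad_slope b c y y i j" for i j by (intro quad_slope_nonneg nn y)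
    show "0 \<le> y i - z i" for i using zy[of i] by simp
    fix i
    have "y i - z i = (\<Sum>j\<in>UNIV. quad_slope b c y z i j * (y j - z j))"
      using quad_map_diff[of a b c y i z] y z by (simp add: least_fixpoint_def)
    also have "\<dots> \<le> (\<Sum>j\<in>UNIV. quad_slope b c y y i j * (y j - z j))"
      using zy by (intro sum_mono mult_right_mono quad_slope_mono nn) auto
    finally show "y i - z i \<le> \<dots>" .
  qed
  then have "z = y" by auto
  with z show ?thesis by simp
qed


section \<open>Analytic dependence of the least fixed point\<close>

lemma quad_map_of_real:
  "quad_map (\<lambda>i. of_real (a i)) (\<lambda>i j. of_real (b i j)) (\<lambda>i j k. of_real (c i j k)) (\<lambda>i. of_real (x i))
     = (\<lambda>i. complex_of_real (quad_map a b c x i))"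
  by (simp add: quad_map_def fun_eq_iff)

lemma norm_quad_slope_le:
  fixes b :: "'i::finite \<Rightarrow> 'i \<Rightarrow> complex"
  assumes "\<And>i. norm (x i) \<le> u i" "\<And>i. norm (y i) \<le> u i"
  shows "norm (quad_slope b c x y i j) \<le> quad_slope (\<lambda>i j. norm (b i j)) (\<lambda>i j k. norm (c i j k)) u u i j"
proof -
  have "norm (quad_slope b c x y i j) \<le> norm (b i j) + (\<Sum>k\<in>UNIV. norm (c i j k * y k + c i k j * x k))"
    unfolding quad_slope_def by (rule order_trans[OF norm_triangle_ineq]) (intro add_left_mono norm_sum)
  also have "\<dots> \<le> norm (b i j) + (\<Sum>k\<in>UNIV. norm (c i j k) * u k + norm (c i k j) * u k)"
    by (intro add_left_mono sum_mono order_trans[OF norm_triangle_ineq] add_mono)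
       (simp_all add: norm_mult mult_left_mono assms)
  finally show ?thesis by (simp add: quad_slope_def)
qed

text \<open>
  The Banach fixed-point argument in the norm \<open>max |x\<^sub>i| / w\<^sub>i\<close>, uniformly in a complex parameter:
  the strict inequality for \<open>w\<close> survives, with a fixed factor \<open>\<theta> < 1\<close>, on a ball of radius \<open>\<rho>\<close>
  around \<open>y\<close> and for all parameters in a small disc. The last conclusion keeps the
  subcriticality at the moved fixed point, which is what identifies it later as the least one.
\<close>

lemma holomorphic_fixpoint:
  fixes \<alpha> :: "complex \<Rightarrow> 'i::finite \<Rightarrow> complex"
  assumes r: "r > 0"
    and hol: "\<And>i. (\<lambda>z. \<alpha> z i) holomorphic_on ball 0 r" "\<And>i j. (\<lambda>z. \<beta> z i j) holomorphic_on ball 0 r"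
      "\<And>i j k. (\<lambda>z. \<gamma> z i j k) holomorphic_on ball 0 r"
    and y: "quad_map (\<alpha> 0) (\<beta> 0) (\<gamma> 0) y = y"
    and w: "\<And>i. 0 < w i"
      "\<And>i. (\<Sum>j\<in>UNIV. quad_slope (\<lambda>i j. norm (\<beta> 0 i j)) (\<lambda>i j k. norm (\<gamma> 0 i j k)) (\<lambda>i. norm (y i)) (\<lambda>i. norm (y i)) i j * w j) < w i"
  obtains s g where "0 < s" "s \<le> r" "\<And>i. (\<lambda>z. g z i) holomorphic_on ball 0 s" "g 0 = y"
    "\<And>z i. norm z < s \<Longrightarrow> (\<lambda>n. (quad_map (\<alpha> z) (\<beta> z) (\<gamma> z) ^^ n) y i) \<longlonglongrightarrow> g z i"
    "\<And>z. norm z < s \<Longrightarrow> quad_map (\<alpha> z) (\<beta> z) (\<gamma> z) (g z) = g z"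
    "\<And>z i. norm z < s \<Longrightarrow> (\<Sum>j\<in>UNIV. quad_slope (\<lambda>i j. norm (\<beta> z i j)) (\<lambda>i j k. norm (\<gamma> z i j k)) (\<lambda>i. norm (g z i)) (\<lambda>i. norm (g z i)) i j * w j) < w i"
proof -
  define L where "L z \<rho> i = (\<Sum>j\<in>UNIV. quad_slope (\<lambda>i j. norm (\<beta> z i j)) (\<lambda>i j k. norm (\<gamma> z i j k))
    (\<lambda>i. norm (y i) + \<rho> * w i) (\<lambda>i. norm (y i) + \<rho> * w i) i j * w j)" for z \<rho> i
  define \<Gamma> where "\<Gamma> z = quad_map (\<alpha> z) (\<beta> z) (\<gamma> z)" for z
  have cont: "((\<lambda>z. h z) \<longlongrightarrow> h 0) (nhds 0)" if "h holomorphic_on ball 0 r" for h :: "complex \<Rightarrow> complex"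
  proof -
    have "isCont h 0" using holomorphic_on_imp_continuous_on[OF that] r
      by (auto simp: continuous_on_eq_continuous_at)
    then show ?thesis by (simp add: continuous_at tendsto_at_iff_tendsto_nhds)
  qed

  \<comment> \<open>the contraction factor at the centre of the ball, for the parameter \<open>0\<close>\<close>
  have "\<forall>\<^sub>F t in at_left 1. \<forall>i. L 0 0 i < t * w i"
  proof (rule eventually_all_finite)
    fix i
    have "((\<lambda>t. t * w i) \<longlongrightarrow> 1 * w i) (at_left 1)" by (intro tendsto_intros)
    moreover have "L 0 0 i < 1 * w i" using w(2)[of i] by (simp add: L_def)
    ultimately show "\<forall>\<^sub>F t in at_left 1. L 0 0 i < t * w i" by (rule order_tendstoD)
  qed
  moreover have "\<forall>\<^sub>F t in at_left (1::real). t < 1 \<and> 0 < t"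
    by (rule eventually_mono[OF eventually_at_left_real[of 0 "1::real"]]) auto
  ultimately have "\<forall>\<^sub>F t in at_left 1. (\<forall>i. L 0 0 i < t * w i) \<and> t < 1 \<and> 0 < t"
    by eventually_elim simp
  then obtain \<theta> where \<theta>: "\<And>i. L 0 0 i < \<theta> * w i" "\<theta> < 1" "0 < \<theta>"
    by (auto dest!: eventually_happens)

  \<comment> \<open>the radius of the ball, still for the parameter \<open>0\<close>\<close>
  have "\<forall>\<^sub>F \<rho> in at_right 0. \<forall>i. L 0 \<rho> i < \<theta> * w i"
  proof (rule eventually_all_finite)
    fix i
    have "((\<lambda>\<rho>. L 0 \<rho> i) \<longlongrightarrow> L 0 0 i) (at_right 0)"
      unfolding L_def quad_slope_def by (intro tendsto_intros)
    then show "\<forall>\<^sub>F \<rho> in at_right 0. L 0 \<rho> i < \<theta> * w i" using \<theta>(1) by (rule order_tendstoD)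
  qed
  moreover have "\<forall>\<^sub>F \<rho> in at_right (0::real). 0 < \<rho>" by (simp add: eventually_at_right_less)
  ultimately have "\<forall>\<^sub>F \<rho> in at_right 0. (\<forall>i. L 0 \<rho> i < \<theta> * w i) \<and> 0 < \<rho>"
    by eventually_elim simp
  then obtain \<rho> where \<rho>: "\<And>i. L 0 \<rho> i < \<theta> * w i" "0 < \<rho>"
    by (auto dest!: eventually_happens)

  \<comment> \<open>the disc of parameters, on which the first step moves the centre by at most \<open>1 - \<theta>\<close> times the radius\<close>
  have "\<forall>\<^sub>F z in nhds 0. \<forall>i. L z \<rho> i < \<theta> * w i"
  proof (rule eventually_all_finite)
    fix i
    have "((\<lambda>z. L z \<rho> i) \<longlongrightarrow> L 0 \<rho> i) (nhds 0)"
      unfolding L_def quad_slope_def by (intro tendsto_intros cont hol)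
    then show "\<forall>\<^sub>F z in nhds 0. L z \<rho> i < \<theta> * w i" using \<rho>(1) by (rule order_tendstoD)
  qed
  moreover have "\<forall>\<^sub>F z in nhds 0. \<forall>i. norm (\<Gamma> z y i - y i) < (1 - \<theta>) * \<rho> * w i"
  proof (rule eventually_all_finite)
    fix i
    have "((\<lambda>z. norm (\<Gamma> z y i - y i)) \<longlongrightarrow> norm (\<Gamma> 0 y i - y i)) (nhds 0)"
      unfolding \<Gamma>_def quad_map_def by (intro tendsto_intros cont hol)
    moreover have "norm (\<Gamma> 0 y i - y i) < (1 - \<theta>) * \<rho> * w i" using y w(1)[of i] \<rho>(2) \<theta> by (simp add: \<Gamma>_def)
    ultimately show "\<forall>\<^sub>F z in nhds 0. norm (\<Gamma> z y i - y i) < (1 - \<theta>) * \<rho> * w i" by (rule order_tendstoD)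
  qed
  ultimately have "\<forall>\<^sub>F z in nhds 0. (\<forall>i. L z \<rho> i < \<theta> * w i) \<and> (\<forall>i. norm (\<Gamma> z y i - y i) < (1 - \<theta>) * \<rho> * w i)"
    by eventually_elim simp
  then obtain s' where s': "s' > 0" "\<And>z i. norm z < s' \<Longrightarrow> L z \<rho> i < \<theta> * w i"
    "\<And>z i. norm z < s' \<Longrightarrow> norm (\<Gamma> z y i - y i) < (1 - \<theta>) * \<rho> * w i"
    by (auto simp: eventually_nhds_metric)
  define s where "s = min r s'"
  have s: "0 < s" "s \<le> r" using r s'(1) by (auto simp: s_def)
  have L: "L z \<rho> i < \<theta> * w i" and start: "norm (\<Gamma> z y i - y i) \<le> (1 - \<theta>) * \<rho> * w i" if "norm z < s" for z i
    using s'(2,3)[of z i] that by (auto simp: s_def)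

  have near: "norm (x i) \<le> norm (y i) + \<rho> * w i" if "norm (x i - y i) \<le> \<rho> * w i" for x i
    using norm_triangle_sub[of "x i" "y i"] that by simp
  have contract: "norm (\<Gamma> z x i - \<Gamma> z x' i) \<le> \<theta> * m * w i"
    if z: "norm z < s" and x: "\<And>i. norm (x i - y i) \<le> \<rho> * w i" and x': "\<And>i. norm (x' i - y i) \<le> \<rho> * w i"
      and m: "0 \<le> m" "\<And>i. norm (x i - x' i) \<le> m * w i" for z x x' m i
  proof -
    have "norm (\<Gamma> z x i - \<Gamma> z x' i) \<le> (\<Sum>j\<in>UNIV. norm (quad_slope (\<beta> z) (\<gamma> z) x x' i j * (x j - x' j)))"
      unfolding \<Gamma>_def quad_map_diff by (rule norm_sum)
    also have "\<dots> \<le> (\<Sum>j\<in>UNIV. quad_slope (\<lambda>i j. norm (\<beta> z i j)) (\<lambda>i j k. norm (\<gamma> z i j k))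
        (\<lambda>i. norm (y i) + \<rho> * w i) (\<lambda>i. norm (y i) + \<rho> * w i) i j * (m * w j))"
      unfolding norm_mult
      by (intro sum_mono mult_mono norm_quad_slope_le near x x' m norm_ge_zero)
         (auto intro!: quad_slope_nonneg add_nonneg_nonneg mult_nonneg_nonneg less_imp_le[OF w(1)] less_imp_le[OF \<rho>(2)])
    also have "\<dots> = m * L z \<rho> i" by (simp add: L_def sum_distrib_left mult_ac)
    also have "\<dots> \<le> m * (\<theta> * w i)" using L[OF z, of i] m(1) by (intro mult_left_mono) auto
    finally show ?thesis by (simp add: mult_ac)
  qed

  define X where "X n z = (\<Gamma> z ^^ n) y" for n z
  have X_Suc: "X (Suc n) z = \<Gamma> z (X n z)" and X_0: "X 0 z = y" for n z by (simp_all add: X_def)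
  have X_near: "norm (X n z i - y i) \<le> \<rho> * w i" if z: "norm z < s" for n z i
  proof (induction n arbitrary: i)
    case 0
    then show ?case using \<rho>(2) w(1)[of i] by (simp add: X_0)
  next
    case (Suc n)
    have "norm (\<Gamma> z (X n z) i - \<Gamma> z y i) \<le> \<theta> * \<rho> * w i"
      using Suc \<rho>(2) less_imp_le[OF w(1)] by (intro contract[OF z]) auto
    then show ?case
      using start[OF z, of i] norm_triangle_ineq[of "\<Gamma> z (X n z) i - \<Gamma> z y i" "\<Gamma> z y i - y i"]
      by (simp add: X_Suc algebra_simps)
  qed
  have X_step: "norm (X (Suc n) z i - X n z i) \<le> \<theta> ^ n * ((1 - \<theta>) * \<rho>) * w i" if z: "norm z < s" for n z i
  proof (induction n arbitrary: i)
    case 0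
    then show ?case using start[OF z] by (simp add: X_Suc X_0)
  next
    case (Suc n)
    have "norm (\<Gamma> z (X (Suc n) z) i - \<Gamma> z (X n z) i) \<le> \<theta> * (\<theta> ^ n * ((1 - \<theta>) * \<rho>)) * w i"
      using Suc \<theta> \<rho>(2) by (intro contract[OF z X_near[OF z] X_near[OF z]]) auto
    then show ?case by (simp add: X_Suc mult_ac)
  qed
  have X_hol: "(\<lambda>z. X n z i) holomorphic_on ball 0 s" for n i
  proof (induction n arbitrary: i)
    case (Suc n)
    have "(\<lambda>z. \<alpha> z i) holomorphic_on ball 0 s" "(\<lambda>z. \<beta> z i j) holomorphic_on ball 0 s"
      "(\<lambda>z. \<gamma> z i j k) holomorphic_on ball 0 s" for i j k
      using s(2) by (auto intro: holomorphic_on_subset[OF hol(1)] holomorphic_on_subset[OF hol(2)] holomorphic_on_subset[OF hol(3)])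
    then show ?case
      unfolding X_Suc \<Gamma>_def quad_map_def by (intro holomorphic_intros Suc)
  qed (simp add: X_0)

  define g where "g z i = y i + (\<Sum>n. X (Suc n) z i - X n z i)" for z i
  have lim: "uniform_limit (ball 0 s) (\<lambda>n z. X n z i) (\<lambda>z. g z i) sequentially" for i
  proof -
    have "uniform_limit (ball 0 s) (\<lambda>n z. \<Sum>k<n. X (Suc k) z i - X k z i) (\<lambda>z. \<Sum>k. X (Suc k) z i - X k z i) sequentially"
    proof (rule Weierstrass_m_test)
      show "norm (X (Suc n) z i - X n z i) \<le> \<theta> ^ n * ((1 - \<theta>) * \<rho>) * w i" if "z \<in> ball 0 s" for n z
        using X_step that by simp
      show "summable (\<lambda>n. \<theta> ^ n * ((1 - \<theta>) * \<rho>) * w i)"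
        using \<theta> by (intro summable_mult2 summable_geometric) auto
    qed
    then have "uniform_limit (ball 0 s) (\<lambda>n z. y i + (\<Sum>k<n. X (Suc k) z i - X k z i)) (\<lambda>z. g z i) sequentially"
      unfolding g_def by (intro uniform_limit_intros)
    moreover have "y i + (\<Sum>k<n. X (Suc k) z i - X k z i) = X n z i" for n z
      using sum_lessThan_telescope[of "\<lambda>k. X k z i" n] by (simp add: X_0)
    ultimately show ?thesis by simp
  qed
  have lim_pt: "(\<lambda>n. X n z i) \<longlonglongrightarrow> g z i" if "norm z < s" for z i
    using tendsto_uniform_limitI[OF lim] that by simp
  have g_near: "norm (g z i - y i) \<le> \<rho> * w i" if z: "norm z < s" for z i
  proof (rule LIMSEQ_le_const2)
    show "(\<lambda>n. norm (X n z i - y i)) \<longlonglongrightarrow> norm (g z i - y i)" by (intro tendsto_intros lim_pt z)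
  qed (use X_near[OF z] in auto)
  show thesis
  proof (rule that[of s g])
    show "(\<lambda>z. g z i) holomorphic_on ball 0 s" for i
    proof (rule holomorphic_uniform_sequence[OF open_ball X_hol])
      fix z :: complex assume "z \<in> ball 0 s"
      then obtain d where d: "0 < d" "cball z d \<subseteq> ball 0 s" using open_ball[of "0::complex" s]
        unfolding open_contains_cball by blast
      then show "\<exists>d>0. cball z d \<subseteq> ball 0 s \<and> uniform_limit (cball z d) (\<lambda>n z. X n z i) (\<lambda>z. g z i) sequentially"
        using uniform_limit_on_subset[OF lim d(2)] by blast
    qed
    have "X n 0 = y" for n by (induction n) (simp_all add: X_0 X_Suc \<Gamma>_def y)
    then show "g 0 = y" by (simp add: g_def fun_eq_iff)
    fix z :: complex assume z: "norm z < s"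
    show "(\<lambda>n. (quad_map (\<alpha> z) (\<beta> z) (\<gamma> z) ^^ n) y i) \<longlonglongrightarrow> g z i" for i
      using lim_pt[OF z] by (simp add: X_def \<Gamma>_def)
    show "quad_map (\<alpha> z) (\<beta> z) (\<gamma> z) (g z) = g z"
    proof
      fix i
      have "(\<lambda>n. X (Suc n) z i) \<longlonglongrightarrow> quad_map (\<alpha> z) (\<beta> z) (\<gamma> z) (g z) i"
        unfolding X_Suc \<Gamma>_def by (rule tendsto_quad_map) (rule lim_pt[OF z])
      then show "quad_map (\<alpha> z) (\<beta> z) (\<gamma> z) (g z) i = g z i"
        using LIMSEQ_Suc[OF lim_pt[OF z, of i]] by (rule LIMSEQ_unique)
    qed
    fix i
    have "(\<Sum>j\<in>UNIV. quad_slope (\<lambda>i j. norm (\<beta> z i j)) (\<lambda>i j k. norm (\<gamma> z i j k)) (\<lambda>i. norm (g z i)) (\<lambda>i. norm (g z i)) i j * w j)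
        \<le> L z \<rho> i"
      unfolding L_def by (intro sum_mono mult_right_mono quad_slope_mono near g_near z less_imp_le[OF w(1)]) simp
    also have "\<dots> < w i" using L[OF z, of i] mult_strict_right_mono[OF \<theta>(2) w(1)[of i]] by simp
    finally show "(\<Sum>j\<in>UNIV. quad_slope (\<lambda>i j. norm (\<beta> z i j)) (\<lambda>i j k. norm (\<gamma> z i j k)) (\<lambda>i. norm (g z i)) (\<lambda>i. norm (g z i)) i j * w j) < w i" .
  qed (use s in auto)
qed

text \<open>
  For real parameters the iterates started at the nonnegative real vector \<open>y\<close> are real and
  nonnegative, so the holomorphic fixed point restricts to a nonnegative real one; it is the least
  because it is still subcritical.
\<close>

theorem least_fixpoint_analytic:
  fixes a :: "real \<Rightarrow> 'i::finite \<Rightarrow> real"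
  assumes germ: "\<And>i. analytic_germ (\<lambda>e. a e i)" "\<And>i j. analytic_germ (\<lambda>e. b e i j)"
      "\<And>i j k. analytic_germ (\<lambda>e. c e i j k)"
    and nn: "\<forall>\<^sub>F e in nhds 0. (\<forall>i. 0 \<le> a e i) \<and> (\<forall>i j. 0 \<le> b e i j) \<and> (\<forall>i j k. 0 \<le> c e i j k)"
    and y: "\<And>i. 0 \<le> y i" "quad_map (a 0) (b 0) (c 0) y = y"
    and w: "\<And>i. 0 < w i" "\<And>i. (\<Sum>j\<in>UNIV. quad_slope (b 0) (c 0) y y i j * w j) < w i"
  obtains g where "\<And>i. analytic_germ (\<lambda>e. g e i)" "g 0 = y"
    "\<forall>\<^sub>F e in nhds 0. least_fixpoint (a e) (b e) (c e) (g e)"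
proof -
  obtain r1 \<alpha> where \<alpha>: "r1 > 0" "\<And>i. \<alpha> i holomorphic_on ball 0 r1"
    "\<And>i e. \<bar>e\<bar> < r1 \<Longrightarrow> \<alpha> i (complex_of_real e) = of_real (a e i)"
    using analytic_germ_extension[of "\<lambda>i e. a e i", OF germ(1)] by blast
  obtain r2 \<beta> where \<beta>: "r2 > 0" "\<And>p. \<beta> p holomorphic_on ball 0 r2"
    "\<And>p e. \<bar>e\<bar> < r2 \<Longrightarrow> \<beta> p (complex_of_real e) = of_real (b e (fst p) (snd p))"
    using analytic_germ_extension[of "\<lambda>p e. b e (fst p) (snd p)", OF germ(2)] by blast
  obtain r3 \<gamma> where \<gamma>: "r3 > 0" "\<And>p. \<gamma> p holomorphic_on ball 0 r3"
    "\<And>p e. \<bar>e\<bar> < r3 \<Longrightarrow> \<gamma> p (complex_of_real e) = of_real (c e (fst p) (fst (snd p)) (snd (snd p)))"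
    using analytic_germ_extension[of "\<lambda>p e. c e (fst p) (fst (snd p)) (snd (snd p))", OF germ(3)] by blast
  obtain r4 where r4: "r4 > 0" and "\<And>e. \<bar>e\<bar> < r4 \<Longrightarrow>
      (\<forall>i. 0 \<le> a e i) \<and> (\<forall>i j. 0 \<le> b e i j) \<and> (\<forall>i j k. 0 \<le> c e i j k)"
    using nn by (auto simp: eventually_nhds_metric)
  then have nn: "0 \<le> a e i" "0 \<le> b e i j" "0 \<le> c e i j k" if "\<bar>e\<bar> < r4" for e i j k
    using that by blast+
  define r where "r = min (min r1 r2) (min r3 r4)"
  have r: "r > 0" using \<alpha>(1) \<beta>(1) \<gamma>(1) r4 by (simp add: r_def)
  have ext: "\<alpha> i (of_real e) = of_real (a e i)" "\<beta> (i,j) (of_real e) = of_real (b e i j)"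
    "\<gamma> (i,j,k) (of_real e) = of_real (c e i j k)" if "\<bar>e\<bar> < r" for e i j k
    using \<alpha>(3) \<beta>(3) \<gamma>(3) that by (simp_all add: r_def)
  have ext0: "\<alpha> i 0 = of_real (a 0 i)" "\<beta> (i,j) 0 = of_real (b 0 i j)" "\<gamma> (i,j,k) 0 = of_real (c 0 i j k)" for i j k
    using ext[of 0] r by simp_all
  obtain s g where s: "0 < s" "s \<le> r" and g: "\<And>i. (\<lambda>z. g z i) holomorphic_on ball 0 s" "g 0 = (\<lambda>i. of_real (y i))"
    "\<And>z i. norm z < s \<Longrightarrow> (\<lambda>n. (quad_map (\<lambda>i. \<alpha> i z) (\<lambda>i j. \<beta> (i,j) z) (\<lambda>i j k. \<gamma> (i,j,k) z) ^^ n) (\<lambda>i. of_real (y i)) i) \<longlonglongrightarrow> g z i"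
    "\<And>z. norm z < s \<Longrightarrow> quad_map (\<lambda>i. \<alpha> i z) (\<lambda>i j. \<beta> (i,j) z) (\<lambda>i j k. \<gamma> (i,j,k) z) (g z) = g z"
    "\<And>z i. norm z < s \<Longrightarrow> (\<Sum>j\<in>UNIV. quad_slope (\<lambda>i j. norm (\<beta> (i,j) z)) (\<lambda>i j k. norm (\<gamma> (i,j,k) z)) (\<lambda>i. norm (g z i)) (\<lambda>i. norm (g z i)) i j * w j) < w i"
  proof (rule holomorphic_fixpoint[of r "\<lambda>z i. \<alpha> i z" "\<lambda>z i j. \<beta> (i,j) z" "\<lambda>z i j k. \<gamma> (i,j,k) z" "\<lambda>i. of_real (y i)" w])
    show "\<alpha> i holomorphic_on ball 0 r" "\<beta> (i,j) holomorphic_on ball 0 r" "\<gamma> (i,j,k) holomorphic_on ball 0 r" for i j k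
      by (auto simp: r_def intro: holomorphic_on_subset[OF \<alpha>(2)] holomorphic_on_subset[OF \<beta>(2)] holomorphic_on_subset[OF \<gamma>(2)])
    show "quad_map (\<lambda>i. \<alpha> i 0) (\<lambda>i j. \<beta> (i,j) 0) (\<lambda>i j k. \<gamma> (i,j,k) 0) (\<lambda>i. of_real (y i)) = (\<lambda>i. of_real (y i))"
      by (simp add: ext0 quad_map_of_real y fun_eq_iff)
    show "(\<Sum>j\<in>UNIV. quad_slope (\<lambda>i j. norm (\<beta> (i,j) 0)) (\<lambda>i j k. norm (\<gamma> (i,j,k) 0))
        (\<lambda>i. norm (complex_of_real (y i))) (\<lambda>i. norm (complex_of_real (y i))) i j * w j) < w i" for i
      using w(2)[of i] nn[of 0] r4 y(1) by (simp add: ext0)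
  qed (use r w in auto)
  have real: "g (of_real e) i = of_real (Re (g (of_real e) i))" (is ?real)
    and pos: "0 \<le> Re (g (of_real e) i)" if e: "\<bar>e\<bar> < s" for e i
  proof -
    have er: "\<bar>e\<bar> < r" "\<bar>e\<bar> < r4" "norm (complex_of_real e) < s" using e s by (simp_all add: r_def)
    define x where "x n = (quad_map (a e) (b e) (c e) ^^ n) y" for n
    have "(quad_map (\<lambda>i. \<alpha> i (of_real e)) (\<lambda>i j. \<beta> (i,j) (of_real e)) (\<lambda>i j k. \<gamma> (i,j,k) (of_real e)) ^^ n) (\<lambda>i. of_real (y i))
        = (\<lambda>i. of_real (x n i))" for n
      by (induction n) (simp_all add: x_def ext[OF er(1)] quad_map_of_real)
    then have lim: "(\<lambda>n. complex_of_real (x n i)) \<longlonglongrightarrow> g (of_real e) i" using g(3)[OF er(3), of i] by simp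
    have "(\<lambda>n. Re (of_real (x n i))) \<longlonglongrightarrow> Re (g (of_real e) i)" by (rule tendsto_Re[OF lim])
    then have lim': "(\<lambda>n. x n i) \<longlonglongrightarrow> Re (g (of_real e) i)" by simp
    then have "(\<lambda>n. complex_of_real (x n i)) \<longlonglongrightarrow> of_real (Re (g (of_real e) i))" by (rule tendsto_of_real)
    with lim show ?real by (rule LIMSEQ_unique)
    have "0 \<le> x n i" for n i
      by (induction n arbitrary: i) (simp_all add: x_def y quad_map_nonneg nn[OF er(2)])
    then show "0 \<le> Re (g (of_real e) i)" by (intro LIMSEQ_le_const[OF lim']) auto
  qed
  show thesis
  proof (rule that[of "\<lambda>e i. Re (g (of_real e) i)"])
    show "analytic_germ (\<lambda>e. Re (g (of_real e) i))" for i
      unfolding analytic_germ_def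
    proof (intro exI conjI)
      show "(\<lambda>z. g z i) analytic_on {0}" using g(1)[of i] s(1) by (auto simp: analytic_at_ball)
      show "\<forall>\<^sub>F e in nhds 0. g (complex_of_real e) i = of_real (Re (g (of_real e) i))"
        using s(1) real by (auto simp: eventually_nhds_metric)
    qed
    show "(\<lambda>i. Re (g (complex_of_real 0) i)) = y" using g(2) by simp
    have "least_fixpoint (a e) (b e) (c e) (\<lambda>i. Re (g (of_real e) i))" if e: "\<bar>e\<bar> < s" for e
    proof (rule subcritical_fixpoint_least)
      have er: "\<bar>e\<bar> < r" "\<bar>e\<bar> < r4" "norm (complex_of_real e) < s" using e s by (simp_all add: r_def)
      show "0 \<le> a e i" "0 \<le> b e i j" "0 \<le> c e i j k" for i j k using nn er by auto
      show "0 \<le> Re (g (of_real e) i)" for i by (rule pos[OF e])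
      define G where "G i = Re (g (of_real e) i)" for i
      have gG: "g (of_real e) = (\<lambda>i. of_real (G i))" using real[OF e] by (simp add: G_def fun_eq_iff)
      have "complex_of_real (quad_map (a e) (b e) (c e) G i) = of_real (G i)" for i
        using fun_cong[OF g(4)[OF er(3)], of i] unfolding gG ext[OF er(1)] quad_map_of_real .
      then show "quad_map (a e) (b e) (c e) (\<lambda>i. Re (g (of_real e) i)) = (\<lambda>i. Re (g (of_real e) i))"
        by (simp only: of_real_eq_iff flip: G_def) blast
      show "(\<Sum>j\<in>UNIV. quad_slope (b e) (c e) (\<lambda>i. Re (g (of_real e) i)) (\<lambda>i. Re (g (of_real e) i)) i j * w j) < w i" for i
        using g(5)[OF er(3), of i] pos[OF e] nn[OF er(2)] unfolding gG ext[OF er(1)]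
        by (simp flip: G_def)
    qed (rule w)
    then show "\<forall>\<^sub>F e in nhds 0. least_fixpoint (a e) (b e) (c e) (\<lambda>i. Re (g (of_real e) i))"
      using s(1) by (auto simp: eventually_nhds_metric)
  qed
qed


section \<open>Eliminating the zero phases of an irreducible generator\<close>

lemma bounded_bilinear_matrix_mult:
  "bounded_bilinear ((**) :: real^'n^'m \<Rightarrow> real^'p^'n \<Rightarrow> real^'p^'m)"
  unfolding bilinear_conv_bounded_bilinear[symmetric] bilinear_def
  by (auto intro!: linearI simp: vec_eq_iff matrix_matrix_mult_def sum.distrib algebra_simps sum_distrib_left)

lemmas matrix_mult_simps =
  bounded_bilinear.add_left[OF bounded_bilinear_matrix_mult]
  bounded_bilinear.add_right[OF bounded_bilinear_matrix_mult]
  bounded_bilinear.diff_left[OF bounded_bilinear_matrix_mult]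
  bounded_bilinear.diff_right[OF bounded_bilinear_matrix_mult]
  bounded_bilinear.minus_left[OF bounded_bilinear_matrix_mult]
  bounded_bilinear.minus_right[OF bounded_bilinear_matrix_mult]
  bounded_bilinear.zero_left[OF bounded_bilinear_matrix_mult]
  bounded_bilinear.zero_right[OF bounded_bilinear_matrix_mult]

lemma block_nth [simp]: "block I J M $ i $ j = (if i \<in> I \<and> j \<in> J then M $ i $ j else 0)"
  by (simp add: block_def)

lemma matrix_mult_nth: "(M ** N) $ i $ j = (\<Sum>k\<in>UNIV. M $ i $ k * N $ k $ j)"
  by (simp add: matrix_matrix_mult_def)

lemma matrix_vector_nth: "(M *v x) $ i = (\<Sum>k\<in>UNIV. M $ i $ k * x $ k)"
  by (simp add: matrix_vector_mult_def)

lemma generator_row_sum: "generator A \<Longrightarrow> (\<Sum>j\<in>UNIV. A $ i $ j) = 0"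
  using matrix_vector_nth[of A 1 i] by (simp add: generator_def)

text \<open>
  At a minimum with negative value all neighbours attain the minimum as well; irreducibility
  would spread it to all phases, including one outside \<open>Z\<close>.
\<close>

lemma generator_minimum_principle:
  fixes A :: "real^'s^'s"
  assumes gen: "generator A" and irr: "irreducible_matrix A" and Z: "Z \<noteq> UNIV"
    and le: "\<And>i. i \<in> Z \<Longrightarrow> (A *v h) $ i \<le> 0" and off: "\<And>i. i \<notin> Z \<Longrightarrow> 0 \<le> h $ i"
  shows "0 \<le> h $ i"
proof -
  define m where "m = Min (range (($) h))"
  have m_le: "m \<le> h $ j" for j by (simp add: m_def)
  have "m \<in> range (($) h)" unfolding m_def by (intro Min_in) auto
  then obtain i0 where i0: "h $ i0 = m" by auto
  have "0 \<le> m"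
  proof (rule ccontr)
    assume "\<not> 0 \<le> m"
    then have inZ: "i \<in> Z" if "h $ i = m" for i using off that by force
    have step: "h $ j = m" if "h $ i = m" "i \<noteq> j" "A $ i $ j \<noteq> 0" for i j
    proof -
      have nn: "0 \<le> A $ i $ k * (h $ k - m)" for k
        using gen m_le[of k] that(1) by (cases "k = i") (auto simp: generator_def)
      have "(\<Sum>k\<in>UNIV. A $ i $ k * (h $ k - m)) = (A *v h) $ i - (\<Sum>k\<in>UNIV. A $ i $ k) * m"
        by (simp add: matrix_vector_nth right_diff_distrib sum_subtractf sum_distrib_right)
      also have "\<dots> \<le> 0" using le[OF inZ[OF that(1)]] gen by (simp add: generator_row_sum)
      finally have "(\<Sum>k\<in>UNIV. A $ i $ k * (h $ k - m)) = 0" using nn by (intro antisym sum_nonneg) auto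
      then have "A $ i $ j * (h $ j - m) = 0" using nn by (simp add: sum_nonneg_eq_0_iff)
      with that(3) show ?thesis by simp
    qed
    have "h $ j = m" for j
    proof -
      have "(i0, j) \<in> {(k, l). k \<noteq> l \<and> A $ k $ l \<noteq> 0}\<^sup>*" using irr by (simp add: irreducible_matrix_def)
      then show ?thesis by (induction rule: rtrancl_induct) (use i0 step in auto)
    qed
    with inZ Z show False by blast
  qed
  with m_le[of i] show ?thesis by simp
qed

lemma generator_kernel_constant:
  fixes A :: "real^'s^'s"
  assumes "generator A" "irreducible_matrix A" "A *v h = 0"
  shows "h $ i = h $ j"
proof -
  have "A *v 1 = 0" using assms(1) by (simp add: generator_def)
  then have A: "A *v (h - (h $ j) *\<^sub>R 1) = 0" "A *v ((h $ j) *\<^sub>R 1 - h) = 0"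
    using assms(3) by (simp_all add: algebra_simps)
  have "0 \<le> (h - (h $ j) *\<^sub>R 1) $ i"
    by (rule generator_minimum_principle[OF assms(1,2), of "UNIV - {j}"]) (auto simp: A)
  moreover have "0 \<le> ((h $ j) *\<^sub>R 1 - h) $ i"
    by (rule generator_minimum_principle[OF assms(1,2), of "UNIV - {j}"]) (auto simp: A)
  ultimately show ?thesis by simp
qed

text \<open>
  The rank-one change \<open>h \<mapsto> A h - (\<xi> \<bullet> h) 1\<close> of the singular matrix \<open>A\<close> is injective, because the
  kernel of \<open>A\<close> consists of the constants. Solving with right-hand side \<open>c\<close> and taking the inner
  product with \<open>\<xi>\<close> identifies \<open>\<xi> \<bullet> h\<close>.
\<close>

lemma poisson_equation_solution:
  fixes A :: "real^'s^'s"
  assumes gen: "generator A" and irr: "irreducible_matrix A" and stat: "stationary_distribution A \<xi>"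
  obtains h where "A *v h = c - (\<xi> \<bullet> c) *\<^sub>R 1"
proof -
  have \<xi>: "\<xi> v* A = 0" "\<xi> \<bullet> 1 = 1" using stat by (simp_all add: stationary_distribution_def)
  have \<xi>A: "\<xi> \<bullet> (A *v x) = 0" for x by (metis \<xi>(1) dot_lmul_matrix inner_zero_left)
  define B where "B = A - (\<chi> i j. \<xi> $ j)"
  have B: "B *v x = A *v x - (\<xi> \<bullet> x) *\<^sub>R 1" for x
    by (simp add: B_def matrix_vector_mult_diff_rdistrib vec_eq_iff) (simp add: matrix_vector_nth inner_vec_def)
  have "inj ((*v) B)"
  proof (subst linear_injective_0[OF matrix_vector_mul_linear], intro allI impI)
    fix x assume 0: "B *v x = 0"
    then have "\<xi> \<bullet> (B *v x) = 0" by simp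
    then have *: "\<xi> \<bullet> x = 0" by (simp add: B inner_diff_right \<xi>A \<xi>(2))
    with 0 have Ax: "A *v x = 0" by (simp add: B)
    have "x = (x $ i) *\<^sub>R 1" for i using generator_kernel_constant[OF gen irr Ax] by (simp add: vec_eq_iff)
    then have "\<xi> \<bullet> x = x $ i" for i by (metis \<xi>(2) inner_scaleR_right mult.right_neutral)
    then show "x = 0" using * by (simp add: vec_eq_iff)
  qed
  then have "surj ((*v) B)" by (intro linear_injective_imp_surjective) auto
  then obtain h where h: "B *v h = c" by (metis surjD)
  have "\<xi> \<bullet> (B *v h) = \<xi> \<bullet> c" by (simp add: h)
  then have "\<xi> \<bullet> h = - (\<xi> \<bullet> c)" by (simp add: B inner_diff_right \<xi>A \<xi>(2))
  then have "A *v h = c - (\<xi> \<bullet> c) *\<^sub>R 1" using h by (simp add: B algebra_simps)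
  then show thesis by (rule that)
qed

text \<open>
  Completing the block on \<open>Z\<close> by the identity turns the inverse of a block into the inverse of a
  full matrix, for which determinants and Cramer's rule are available.
\<close>

definition completed :: "'s::finite set \<Rightarrow> real^'s^'s \<Rightarrow> real^'s^'s" where
  "completed Z A = block Z Z A + block (- Z) (- Z) (mat 1)"

lemma block_inv_eqI:
  fixes M N :: "real^'s^'s"
  assumes N: "N \<in> block_shape I I" "M ** N = block I I (mat 1)" "N ** M = block I I (mat 1)"
  shows "block_inv I M = N"
  unfolding block_inv_def
proof (rule the_equality)
  have unit: "block I I (mat 1) ** X = X" "X ** block I I (mat 1) = X" if "X \<in> block_shape I I" for X :: "real^'s^'s"
  proof -
    have "(\<Sum>k\<in>UNIV. (if i \<in> I \<and> k \<in> I then mat 1 $ i $ k else 0) * X $ k $ j) = X $ i $ j" for i j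
    proof -
      have "(\<Sum>k\<in>UNIV. (if i \<in> I \<and> k \<in> I then mat 1 $ i $ k else 0) * X $ k $ j)
          = (\<Sum>k\<in>UNIV. if k = i then X $ i $ j else 0)"
        using that by (intro sum.cong) (auto simp: block_shape_def mat_def)
      then show ?thesis by simp
    qed
    moreover have "(\<Sum>k\<in>UNIV. X $ i $ k * (if k \<in> I \<and> j \<in> I then mat 1 $ k $ j else 0)) = X $ i $ j" for i j
    proof -
      have "(\<Sum>k\<in>UNIV. X $ i $ k * (if k \<in> I \<and> j \<in> I then mat 1 $ k $ j else 0))
          = (\<Sum>k\<in>UNIV. if k = j then X $ i $ j else 0)"
        using that by (intro sum.cong) (auto simp: block_shape_def mat_def)
      then show ?thesis by simp
    qed
    ultimately show "block I I (mat 1) ** X = X" "X ** block I I (mat 1) = X"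
      by (simp_all add: vec_eq_iff matrix_mult_nth)
  qed
  fix N' assume N': "N' \<in> block_shape I I \<and> M ** N' = block I I (mat 1) \<and> N' ** M = block I I (mat 1)"
  have "N' = N' ** (M ** N)" using N(2) N' unit(2)[of N'] by simp
  also have "\<dots> = (N' ** M) ** N" by (rule matrix_mul_assoc)
  also have "\<dots> = N" using N(1) N' unit(1)[of N] by simp
  finally show "N' = N" .
qed (use N in auto)

lemma matrix_inv_mult:
  assumes "invertible A" shows "A ** matrix_inv A = mat 1" "matrix_inv A ** A = mat 1"
  using someI_ex[OF assms[unfolded invertible_def]] by (simp_all add: matrix_inv_def)

lemma block_inv_properties:
  fixes A :: "real^'s^'s"
  assumes "invertible (completed Z A)"
  shows "block_inv Z (block Z Z A) = block Z Z (matrix_inv (completed Z A))"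
    and "block Z Z A ** block_inv Z (block Z Z A) = block Z Z (mat 1)"
    and "block_inv Z (block Z Z A) ** block Z Z A = block Z Z (mat 1)"
proof -
  let ?B = "completed Z A" and ?V = "matrix_inv (completed Z A)"
  define N where "N = block Z Z (matrix_inv (completed Z A))"
  have V: "?B ** ?V = mat 1" "?V ** ?B = mat 1"
    using matrix_inv_mult[OF assms] by auto
  have l: "(block Z Z A ** N) $ i $ j = block Z Z (mat 1) $ i $ j" for i j
  proof (cases "i \<in> Z \<and> j \<in> Z")
    case True
    have "(block Z Z A ** N) $ i $ j = (?B ** ?V) $ i $ j"
      unfolding matrix_mult_nth by (rule sum.cong) (use True in \<open>auto simp: completed_def N_def\<close>)
    with True V(1) show ?thesis by simp
  qed (auto simp: matrix_mult_nth N_def intro!: sum.neutral)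
  have r: "(N ** block Z Z A) $ i $ j = block Z Z (mat 1) $ i $ j" for i j
  proof (cases "i \<in> Z \<and> j \<in> Z")
    case True
    have "(N ** block Z Z A) $ i $ j = (?V ** ?B) $ i $ j"
      unfolding matrix_mult_nth by (rule sum.cong) (use True in \<open>auto simp: completed_def N_def\<close>)
    with True V(2) show ?thesis by simp
  qed (auto simp: matrix_mult_nth N_def intro!: sum.neutral)
  have lr: "block Z Z A ** N = block Z Z (mat 1)" "N ** block Z Z A = block Z Z (mat 1)"
    using l r by (simp_all add: vec_eq_iff)
  have "block_inv Z (block Z Z A) = N"
    by (rule block_inv_eqI[OF _ lr]) (auto simp: block_shape_def N_def)
  with lr show "block_inv Z (block Z Z A) = block Z Z (matrix_inv (completed Z A))"
    "block Z Z A ** block_inv Z (block Z Z A) = block Z Z (mat 1)"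
    "block_inv Z (block Z Z A) ** block Z Z A = block Z Z (mat 1)" by (simp_all add: N_def)
qed

lemma completed_invertible:
  fixes A :: "real^'s^'s"
  assumes gen: "generator A" and irr: "irreducible_matrix A" and Z: "Z \<noteq> UNIV"
  shows "invertible (completed Z A)"
proof -
  have "x = 0" if "completed Z A *v x = 0" for x
  proof -
    have eq: "(\<Sum>k\<in>UNIV. completed Z A $ i $ k * x $ k) = 0" for i
      using that matrix_vector_nth[of "completed Z A" x i] by simp
    have off: "x $ i = 0" if "i \<notin> Z" for i
    proof -
      have "completed Z A $ i $ k * x $ k = (if k = i then x $ i else 0)" for k
        using that by (auto simp: completed_def mat_def)
      with eq[of i] show ?thesis by simp
    qed
    have on: "(A *v x) $ i = 0" if "i \<in> Z" for i
    proof -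
      have "completed Z A $ i $ k * x $ k = A $ i $ k * x $ k" for k
        using that off[of k] by (cases "k \<in> Z") (auto simp: completed_def)
      with eq[of i] show ?thesis by (simp add: matrix_vector_nth)
    qed
    have "0 \<le> x $ i" for i
      by (rule generator_minimum_principle[OF gen irr Z]) (simp_all add: on off)
    moreover have "0 \<le> (- x) $ i" for i
      by (rule generator_minimum_principle[OF gen irr Z])
        (simp_all add: on off linear_neg[OF matrix_vector_mul_linear])
    ultimately show ?thesis by (simp add: vec_eq_iff order_antisym)
  qed
  then have "inj ((*v) (completed Z A))"
    using linear_injective_0[OF matrix_vector_mul_linear] by blast
  then show ?thesis
    using matrix_left_invertible_injective matrix_left_right_inverse unfolding invertible_def by blast
qed

text \<open>
  A column of \<open>- A\<^sub>Z\<^sub>Z\<^sup>-\<^sup>1\<close> is superharmonic on \<open>Z\<close> and vanishes off \<open>Z\<close>, so the minimum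
  principle applies.
\<close>

lemma block_inv_nonpos:
  fixes A :: "real^'s^'s"
  assumes gen: "generator A" and irr: "irreducible_matrix A" and Z: "Z \<noteq> UNIV"
  shows "block_inv Z (block Z Z A) $ i $ j \<le> 0"
proof -
  define N where "N = block_inv Z (block Z Z A)"
  note inv = block_inv_properties[OF completed_invertible[OF gen irr Z], folded N_def]
  have off: "N $ k $ j = 0" if "k \<notin> Z" for k using that by (simp add: inv(1))
  have "0 \<le> (\<chi> k. - N $ k $ j) $ i"
  proof (rule generator_minimum_principle[OF gen irr Z])
    fix k assume k: "k \<in> Z"
    have "(A *v (\<chi> k. - N $ k $ j)) $ k = - (\<Sum>l\<in>UNIV. A $ k $ l * N $ l $ j)"
      by (simp add: matrix_vector_nth sum_negf)
    also have "(\<Sum>l\<in>UNIV. A $ k $ l * N $ l $ j) = (block Z Z A ** N) $ k $ j"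
      unfolding matrix_mult_nth using k off by (intro sum.cong) auto
    also have "\<dots> = block Z Z (mat 1) $ k $ j" by (simp add: inv(2))
    finally show "(A *v (\<chi> k. - N $ k $ j)) $ k \<le> 0" by (simp add: mat_def)
  qed (simp add: off)
  then show ?thesis by (simp add: N_def)
qed

text \<open>
  On the nonzero phases \<open>Q = A + R A\<close>, where \<open>R = A\<^sub>E\<^sub>Z (- A\<^sub>Z\<^sub>Z\<^sup>-\<^sup>1) \<ge> 0\<close> is the matrix of expected
  sojourns in the zero phases: the columns of \<open>R A\<close> in \<open>Z\<close> cancel those of \<open>A\<close>. In this form
  every equation for \<open>A h\<close> on the full phase space gives one for \<open>Q h\<close>.
\<close>

lemma censored_generator:
  fixes A :: "real^'s^'s"
  assumes gen: "generator A" and irr: "irreducible_matrix A" and c: "c \<noteq> 0"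
  obtains R where "\<And>i k. 0 \<le> R $ i $ k" "\<And>i k. c $ k \<noteq> 0 \<Longrightarrow> R $ i $ k = 0"
    "\<And>h i. c $ i \<noteq> 0 \<Longrightarrow> (fluid_Q c A *v h) $ i = (A *v h) $ i + (R *v (A *v h)) $ i"
    "\<And>i j. c $ i \<noteq> 0 \<Longrightarrow> c $ j \<noteq> 0 \<Longrightarrow> i \<noteq> j \<Longrightarrow> 0 \<le> fluid_Q c A $ i $ j"
proof -
  let ?E = "up_phases c \<union> down_phases c" and ?Z = "zero_phases c"
  have E: "i \<in> ?E \<longleftrightarrow> c $ i \<noteq> 0" and Zi: "i \<in> ?Z \<longleftrightarrow> c $ i = 0" for i
    by (auto simp: up_phases_def down_phases_def zero_phases_def)
  have Z: "?Z \<noteq> UNIV" using c by (auto simp: zero_phases_def vec_eq_iff)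
  define N where "N = block_inv ?Z (block ?Z ?Z A)"
  note inv = block_inv_properties[OF completed_invertible[OF gen irr Z], folded N_def]
  have N_nonpos: "N $ i $ j \<le> 0" for i j unfolding N_def by (rule block_inv_nonpos[OF gen irr Z])
  have A_nn: "0 \<le> A $ i $ j" if "i \<noteq> j" for i j using gen that by (simp add: generator_def)
  define R where "R = block ?E ?Z A ** (- N)"
  have Q: "fluid_Q c A = block ?E ?E A + R ** block ?Z ?E A"
    by (simp add: fluid_Q_def Let_def R_def N_def)
  have R_nn: "0 \<le> R $ i $ k" for i k
    unfolding R_def matrix_mult_nth
    by (intro sum_nonneg mult_nonneg_nonneg) (use N_nonpos in \<open>auto simp: E Zi intro!: A_nn simp del: Un_iff\<close>)
  have R_0: "R $ i $ k = 0" if "c $ k \<noteq> 0" for i k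
    using that by (auto simp: R_def matrix_mult_nth inv(1) Zi intro!: sum.neutral)
  have "R ** block ?Z ?Z A = - block ?E ?Z A"
  proof -
    have "R ** block ?Z ?Z A = - (block ?E ?Z A ** block ?Z ?Z (mat 1))"
      by (simp add: R_def matrix_mult_simps inv(3) flip: matrix_mul_assoc)
    also have "block ?E ?Z A ** block ?Z ?Z (mat 1) = block ?E ?Z A"
    proof -
      have "(\<Sum>k\<in>UNIV. block ?E ?Z A $ i $ k * block ?Z ?Z (mat 1) $ k $ j)
          = (\<Sum>k\<in>UNIV. if k = j then block ?E ?Z A $ i $ j else 0)" for i j
        by (intro sum.cong) (auto simp: mat_def)
      then show ?thesis by (simp add: vec_eq_iff matrix_mult_nth del: block_nth)
    qed
    finally show ?thesis .
  qed
  moreover have "R ** A = R ** block ?Z ?E A + R ** block ?Z ?Z A"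
  proof -
    have "A = block ?Z ?E A + block ?Z ?Z A + block ?E UNIV A"
      by (auto simp: vec_eq_iff E Zi simp del: Un_iff)
    then have "R ** A = R ** block ?Z ?E A + R ** block ?Z ?Z A + R ** block ?E UNIV A"
      by (metis matrix_add_ldistrib)
    moreover have "R ** block ?E UNIV A = 0"
      by (auto simp: vec_eq_iff matrix_mult_nth E R_0 simp del: Un_iff intro!: sum.neutral)
    ultimately show ?thesis by simp
  qed
  moreover have "block ?E UNIV A = block ?E ?E A + block ?E ?Z A"
    by (auto simp: vec_eq_iff E Zi simp del: Un_iff)
  ultimately have Q': "fluid_Q c A = block ?E UNIV A + R ** A" by (simp add: Q)
  show thesis
  proof (rule that[OF R_nn R_0])
    show "(fluid_Q c A *v h) $ i = (A *v h) $ i + (R *v (A *v h)) $ i" if "c $ i \<noteq> 0" for h i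
    proof -
      have "(block ?E UNIV A *v h) $ i = (A *v h) $ i" using that by (simp add: matrix_vector_nth E del: Un_iff)
      then show ?thesis by (simp add: Q' matrix_vector_mult_add_rdistrib matrix_vector_mul_assoc)
    qed
    show "0 \<le> fluid_Q c A $ i $ j" if "c $ i \<noteq> 0" "c $ j \<noteq> 0" "i \<noteq> j" for i j
    proof -
      have "0 \<le> (R ** block ?Z ?E A) $ i $ j"
        unfolding matrix_mult_nth
        by (intro sum_nonneg mult_nonneg_nonneg R_nn) (use that in \<open>auto simp: E Zi intro!: A_nn simp del: Un_iff\<close>)
      with A_nn[OF that(3)] show ?thesis by (simp add: Q E that)
    qed
  qed auto
qed

text \<open>
  The generator with the level as clock: its rows are those of \<open>Q\<close> divided by the absolute rates,
  so both \<open>C\<^sub>+\<^sup>-\<^sup>1 Q\<close> and \<open>|C\<^sub>-\<^sup>-\<^sup>1| Q\<close> are blocks of it. The rows with rate \<open>0\<close> vanish, as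
  \<open>x / 0 = 0\<close>.
\<close>

definition time_changed :: "real^'s \<Rightarrow> real^'s^'s \<Rightarrow> real^'s^'s" where
  "time_changed c A = (\<chi> i j. fluid_Q c A $ i $ j / \<bar>c $ i\<bar>)"

lemma time_changed_nonneg:
  fixes A :: "real^'s^'s"
  assumes "generator A" "irreducible_matrix A" "c \<noteq> 0" "c $ i \<noteq> 0" "c $ j \<noteq> 0" "i \<noteq> j"
  shows "0 \<le> time_changed c A $ i $ j"
proof -
  have "0 \<le> fluid_Q c A $ i $ j" by (rule censored_generator[OF assms(1-3)]) (use assms in blast)
  then show ?thesis by (simp add: time_changed_def)
qed

lemma time_changed_mult: "(time_changed c A *v h) $ i = (fluid_Q c A *v h) $ i / \<bar>c $ i\<bar>"
  by (simp add: time_changed_def matrix_vector_nth sum_divide_distrib)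

lemma time_changed_row_sum:
  fixes A :: "real^'s^'s"
  assumes gen: "generator A" and "irreducible_matrix A" "c \<noteq> 0"
  shows "time_changed c A *v 1 = 0"
proof -
  have "(fluid_Q c A *v 1) $ i = 0" if "c $ i \<noteq> 0" for i
    using assms(1) by (rule_tac censored_generator[OF assms]) (use that in \<open>simp add: generator_def\<close>)
  then show ?thesis by (auto simp: vec_eq_iff time_changed_mult)
qed

text \<open>
  The solution of the Poisson equation satisfies \<open>A h > c\<close>, as the drift \<open>\<xi> \<bullet> c\<close> is negative; in
  the zero phases \<open>A h\<close> is positive and contributes to \<open>Q h\<close> with nonnegative weights.
\<close>

lemma time_changed_drift:
  fixes A :: "real^'s^'s"
  assumes gen: "generator A" and irr: "irreducible_matrix A" and stat: "stationary_distribution A \<xi>"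
    and drift: "\<xi> \<bullet> c < 0"
  obtains h where "\<And>i. c $ i \<noteq> 0 \<Longrightarrow> sgn (c $ i) < (time_changed c A *v h) $ i"
proof -
  obtain h where h: "A *v h = c - (\<xi> \<bullet> c) *\<^sub>R 1" using poisson_equation_solution[OF gen irr stat] .
  have c: "c \<noteq> 0" using drift by auto
  obtain R where R: "\<And>i k. 0 \<le> R $ i $ k" "\<And>i k. c $ k \<noteq> 0 \<Longrightarrow> R $ i $ k = 0"
    "\<And>h i. c $ i \<noteq> 0 \<Longrightarrow> (fluid_Q c A *v h) $ i = (A *v h) $ i + (R *v (A *v h)) $ i"
    by (rule censored_generator[OF gen irr c]) blast
  have "sgn (c $ i) < (time_changed c A *v h) $ i" if i: "c $ i \<noteq> 0" for i
  proof -
    have "0 \<le> R $ i $ k * (A *v h) $ k" for k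
      using R(1)[of i k] R(2)[of k i] drift by (cases "c $ k = 0") (auto simp: h mult_nonneg_nonpos)
    then have "0 \<le> (R *v (A *v h)) $ i" by (simp add: matrix_vector_nth[of R] sum_nonneg)
    then have "c $ i < (fluid_Q c A *v h) $ i" using drift by (simp add: R(3)[OF i]) (simp add: h)
    then have "c $ i / \<bar>c $ i\<bar> < (fluid_Q c A *v h) $ i / \<bar>c $ i\<bar>" using i by (intro divide_strict_right_mono) auto
    then show ?thesis by (simp add: time_changed_mult real_sgn_eq)
  qed
  then show thesis by (rule that)
qed

lemma analytic_germ_matrix_mult:
  fixes M :: "real \<Rightarrow> real^'n^'m" and N :: "real \<Rightarrow> real^'p^'n"
  assumes "\<And>i j. analytic_germ (\<lambda>e. M e $ i $ j)" "\<And>i j. analytic_germ (\<lambda>e. N e $ i $ j)"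
  shows "analytic_germ (\<lambda>e. (M e ** N e) $ i $ j)"
  unfolding matrix_mult_nth by (intro analytic_germ_sum analytic_germ_mult assms)

text \<open>
  The entries of \<open>A\<^sub>0\<^sub>0(\<epsilon>)\<^sup>-\<^sup>1\<close> are quotients of determinants with nonzero denominator at \<open>\<epsilon> = 0\<close>.
\<close>

lemma analytic_germ_fluid_Q:
  fixes A A' :: "real^'s^'s"
  assumes gen: "\<forall>\<^sub>F e in nhds 0. generator (A + e *\<^sub>R A') \<and> irreducible_matrix (A + e *\<^sub>R A')"
    and c: "c \<noteq> 0"
  shows "analytic_germ (\<lambda>e. fluid_Q c (A + e *\<^sub>R A') $ i $ j)"
proof -
  let ?E = "up_phases c \<union> down_phases c" and ?Z = "zero_phases c"
  have Z: "?Z \<noteq> UNIV" using c by (auto simp: zero_phases_def vec_eq_iff)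
  define B where "B e = completed ?Z (A + e *\<^sub>R A')" for e
  have inv: "\<forall>\<^sub>F e in nhds 0. invertible (B e)"
    using gen by eventually_elim (simp add: B_def completed_invertible Z)
  have affine: "analytic_germ (\<lambda>e. (A + e *\<^sub>R A') $ i $ j)" for i j
    by (simp add: analytic_germ_add analytic_germ_const analytic_germ_mult analytic_germ_ident)
  have blk: "analytic_germ (\<lambda>e. block I J (A + e *\<^sub>R A') $ i $ j)" for I J i j
  proof (cases "i \<in> I \<and> j \<in> J")
    case True
    then show ?thesis using affine[of i j] by simp
  next
    case False
    then have "block I J M $ i $ j = 0" for M :: "real^'s^'s" by auto
    then show ?thesis by (simp only: analytic_germ_const)
  qed
  have B: "analytic_germ (\<lambda>e. B e $ i $ j)" for i j
    unfolding B_def completed_def vector_add_component by (intro analytic_germ_add blk analytic_germ_const)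
  define V where "V e k l = det (\<chi> i j. if j = k then axis l 1 $ i else B e $ i $ j) / det (B e)" for e k l
  have V: "analytic_germ (\<lambda>e. V e k l)" for k l
    unfolding V_def
  proof (intro analytic_germ_divide analytic_germ_det B)
    show "det (B 0) \<noteq> 0" using eventually_nhds_x_imp_x[OF inv] by (simp add: invertible_det_nz)
    show "analytic_germ (\<lambda>e. (\<chi> i j. if j = k then axis l 1 $ i else B e $ i $ j) $ i $ j)" for i j
      using B by (cases "j = k") (simp_all add: analytic_germ_const)
  qed
  have N: "analytic_germ (\<lambda>e. block_inv ?Z (block ?Z ?Z (A + e *\<^sub>R A')) $ k $ l)" for k l
  proof (rule analytic_germ_cong)
    show "analytic_germ (\<lambda>e. if k \<in> ?Z \<and> l \<in> ?Z then V e k l else 0)"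
      using V by (cases "k \<in> ?Z"; cases "l \<in> ?Z") (simp_all add: analytic_germ_const)
    show "\<forall>\<^sub>F e in nhds 0. (if k \<in> ?Z \<and> l \<in> ?Z then V e k l else 0) = block_inv ?Z (block ?Z ?Z (A + e *\<^sub>R A')) $ k $ l"
      using inv
    proof eventually_elim
      case (elim e)
      have "B e *v (matrix_inv (B e) *v axis l 1) = axis l 1"
        by (simp add: matrix_vector_mul_assoc matrix_inv_mult[OF elim])
      then have "matrix_inv (B e) *v axis l 1 = (\<chi> k. V e k l)"
        using elim by (simp add: cramer invertible_det_nz V_def)
      then have "matrix_inv (B e) $ k $ l = V e k l"
        by (simp add: matrix_vector_mult_basis vec_eq_iff column_def)
      then show ?case using block_inv_properties(1)[OF elim[unfolded B_def]] by (simp add: B_def)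
    qed
  qed
  have "analytic_germ (\<lambda>e. (- block_inv ?Z (block ?Z ?Z (A + e *\<^sub>R A'))) $ k $ l)" for k l
    using analytic_germ_mult[OF analytic_germ_const[of "- 1"] N[of k l]] by simp
  then show ?thesis
    unfolding fluid_Q_def Let_def vector_add_component
    by (intro analytic_germ_add blk analytic_germ_matrix_mult)
qed


section \<open>The Riccati equation as a fixed-point equation\<close>

definition riccati_residual :: "'s::finite set \<Rightarrow> 's set \<Rightarrow> real^'s^'s \<Rightarrow> real^'s^'s \<Rightarrow> real^'s^'s" where
  "riccati_residual U D T X =
     block U D T + block U U T ** X + X ** block D D T + X ** block D U T ** X"

definition as_matrix :: "('s::finite \<times> 's \<Rightarrow> real) \<Rightarrow> real^'s^'s" where
  "as_matrix x = (\<chi> i j. x (i, j))"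

text \<open>
  The coefficients of \<open>X \<mapsto> X + F X / d\<close>, restricted to the block on \<open>U \<times> D\<close> and \<open>0\<close> elsewhere, with
  matrices read as vectors indexed by pairs. The restriction makes every fixed point vanish outside
  the block, and a strict positive supersolution can be sought on all pairs.
\<close>

definition riccati_const :: "'s::finite set \<Rightarrow> 's set \<Rightarrow> real \<Rightarrow> real^'s^'s \<Rightarrow> 's \<times> 's \<Rightarrow> real" where
  "riccati_const U D d T = (\<lambda>(i, j). block U D T $ i $ j / d)"

definition riccati_lin :: "'s::finite set \<Rightarrow> 's set \<Rightarrow> real \<Rightarrow> real^'s^'s \<Rightarrow> 's \<times> 's \<Rightarrow> 's \<times> 's \<Rightarrow> real" where
  "riccati_lin U D d T = (\<lambda>(i, j) (k, l). if i \<in> U \<and> j \<in> D then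
     (if k = i then if l = j then 1 else 0 else 0) +
     (if l = j then block U U T $ i $ k / d else 0) + (if k = i then block D D T $ l $ j / d else 0) else 0)"

definition riccati_quad :: "'s::finite set \<Rightarrow> 's set \<Rightarrow> real \<Rightarrow> real^'s^'s \<Rightarrow> 's \<times> 's \<Rightarrow> 's \<times> 's \<Rightarrow> 's \<times> 's \<Rightarrow> real" where
  "riccati_quad U D d T = (\<lambda>(i, j) (k, l) (m, n). if i \<in> U \<and> j \<in> D then
     (if k = i then if n = j then block D U T $ l $ m / d else 0 else 0) else 0)"

lemma sum_UNIV_Times: "(\<Sum>p\<in>UNIV. f p) = (\<Sum>i\<in>UNIV. \<Sum>j\<in>UNIV. f (i, j))"
  for f :: "'a::finite \<times> 'b::finite \<Rightarrow> 'c::comm_monoid_add"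
  by (simp add: sum.cartesian_product UNIV_Times_UNIV)

lemma riccati_lin_sum:
  "(\<Sum>q\<in>UNIV. riccati_lin U D d T (i, j) q * x q) = (if i \<in> U \<and> j \<in> D then
     x (i, j) + (block U U T ** as_matrix x + as_matrix x ** block D D T) $ i $ j / d else 0)"
proof (cases "i \<in> U \<and> j \<in> D")
  case True
  let ?a = "\<lambda>k l. (if k = i then if l = j then x (k, l) else 0 else 0)"
  let ?b = "\<lambda>k l. (if l = j then block U U T $ i $ k / d * x (k, l) else 0)"
  let ?c = "\<lambda>k l. (if k = i then block D D T $ l $ j / d * x (k, l) else 0)"
  have "(\<Sum>q\<in>UNIV. riccati_lin U D d T (i, j) q * x q) = (\<Sum>k\<in>UNIV. \<Sum>l\<in>UNIV. ?a k l + ?b k l + ?c k l)"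
    unfolding sum_UNIV_Times by (intro sum.cong) (use True in \<open>auto simp: riccati_lin_def distrib_right simp del: block_nth\<close>)
  also have "\<dots> = (\<Sum>k\<in>UNIV. \<Sum>l\<in>UNIV. ?a k l) + (\<Sum>k\<in>UNIV. \<Sum>l\<in>UNIV. ?b k l) + (\<Sum>l\<in>UNIV. \<Sum>k\<in>UNIV. ?c k l)"
    by (subst (4) sum.swap) (simp only: sum.distrib)
  also have "(\<Sum>k\<in>UNIV. \<Sum>l\<in>UNIV. ?a k l) = (\<Sum>k\<in>UNIV. if k = i then x (k, j) else 0)"
    by (intro sum.cong) auto
  also have "\<dots> = x (i, j)" by simp
  also have "(\<Sum>k\<in>UNIV. \<Sum>l\<in>UNIV. ?b k l) = (block U U T ** as_matrix x) $ i $ j / d"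
    by (simp add: matrix_mult_nth as_matrix_def sum_divide_distrib del: block_nth)
  also have "(\<Sum>l\<in>UNIV. \<Sum>k\<in>UNIV. ?c k l) = (as_matrix x ** block D D T) $ i $ j / d"
    by (simp add: matrix_mult_nth as_matrix_def sum_divide_distrib mult.commute del: block_nth)
  finally show ?thesis using True by (simp add: add_divide_distrib)
qed (auto simp: riccati_lin_def intro!: sum.neutral)

lemma riccati_quad_sum:
  "(\<Sum>q\<in>UNIV. \<Sum>r\<in>UNIV. riccati_quad U D d T (i, j) q r * x q * y r) = (if i \<in> U \<and> j \<in> D then
     (as_matrix x ** block D U T ** as_matrix y) $ i $ j / d else 0)"
proof (cases "i \<in> U \<and> j \<in> D")
  case True
  have "(\<Sum>q\<in>UNIV. \<Sum>r\<in>UNIV. riccati_quad U D d T (i, j) q r * x q * y r)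
      = (\<Sum>k\<in>UNIV. \<Sum>l\<in>UNIV. if k = i then (\<Sum>m\<in>UNIV. block D U T $ l $ m / d * x (k, l) * y (m, j)) else 0)"
    unfolding sum_UNIV_Times
  proof (intro sum.cong refl)
    fix k l
    show "(\<Sum>m\<in>UNIV. \<Sum>n\<in>UNIV. riccati_quad U D d T (i, j) (k, l) (m, n) * x (k, l) * y (m, n))
        = (if k = i then (\<Sum>m\<in>UNIV. block D U T $ l $ m / d * x (k, l) * y (m, j)) else 0)"
    proof (cases "k = i")
      case k: True
      have "(\<Sum>n\<in>UNIV. riccati_quad U D d T (i, j) (k, l) (m, n) * x (k, l) * y (m, n))
          = (\<Sum>n\<in>UNIV. if n = j then block D U T $ l $ m / d * x (k, l) * y (m, n) else 0)" for m
        by (intro sum.cong) (use True k in \<open>auto simp: riccati_quad_def simp del: block_nth\<close>)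
      with k show ?thesis by (simp del: block_nth)
    qed (auto simp: riccati_quad_def intro!: sum.neutral)
  qed
  also have "\<dots> = (\<Sum>l\<in>UNIV. \<Sum>k\<in>UNIV. if k = i then (\<Sum>m\<in>UNIV. block D U T $ l $ m / d * x (k, l) * y (m, j)) else 0)"
    by (rule sum.swap)
  also have "\<dots> = (\<Sum>l\<in>UNIV. \<Sum>m\<in>UNIV. block D U T $ l $ m / d * x (i, l) * y (m, j))" by (simp del: block_nth)
  also have "\<dots> = (\<Sum>l\<in>UNIV. as_matrix x $ i $ l * (block D U T ** as_matrix y) $ l $ j) / d"
    by (simp add: matrix_mult_nth as_matrix_def sum_divide_distrib sum_distrib_left mult_ac del: block_nth)
  also have "\<dots> = (as_matrix x ** block D U T ** as_matrix y) $ i $ j / d"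
    by (simp add: matrix_mult_nth[of "as_matrix x"] flip: matrix_mul_assoc)
  finally show ?thesis using True by simp
qed (auto simp: riccati_quad_def intro!: sum.neutral)

lemma riccati_quad_map:
  "quad_map (riccati_const U D d T) (riccati_lin U D d T) (riccati_quad U D d T) x (i, j) =
     (if i \<in> U \<and> j \<in> D then x (i, j) + riccati_residual U D T (as_matrix x) $ i $ j / d else 0)"
  unfolding quad_map_def riccati_lin_sum riccati_quad_sum
  by (simp add: riccati_const_def riccati_residual_def add_divide_distrib)

text \<open>
  On the diagonal \<open>x = y\<close> this is the map \<open>Z \<mapsto> Z + (K Z + Z U) / d\<close>.
\<close>

lemma riccati_slope_sum:
  "(\<Sum>q\<in>UNIV. quad_slope (riccati_lin U D d T) (riccati_quad U D d T) x y (i, j) q * w q) =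
     (if i \<in> U \<and> j \<in> D then w (i, j) +
       ((block U U T + as_matrix x ** block D U T) ** as_matrix w
        + as_matrix w ** (block D D T + block D U T ** as_matrix y)) $ i $ j / d else 0)"
proof -
  have "(\<Sum>q\<in>UNIV. quad_slope (riccati_lin U D d T) (riccati_quad U D d T) x y (i, j) q * w q)
      = (\<Sum>q\<in>UNIV. riccati_lin U D d T (i, j) q * w q)
        + (\<Sum>q\<in>UNIV. \<Sum>r\<in>UNIV. riccati_quad U D d T (i, j) q r * w q * y r)
        + (\<Sum>q\<in>UNIV. \<Sum>r\<in>UNIV. riccati_quad U D d T (i, j) r q * x r * w q)"
    by (simp add: quad_slope_def sum.distrib sum_distrib_right sum_distrib_left algebra_simps)
  also have "(\<Sum>q\<in>UNIV. \<Sum>r\<in>UNIV. riccati_quad U D d T (i, j) r q * x r * w q)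
      = (\<Sum>r\<in>UNIV. \<Sum>q\<in>UNIV. riccati_quad U D d T (i, j) r q * x r * w q)" by (rule sum.swap)
  finally show ?thesis
    unfolding riccati_lin_sum riccati_quad_sum
    by (simp add: matrix_mult_simps matrix_mul_assoc add_divide_distrib)
qed

lemma riccati_residual_shape:
  "X \<in> block_shape U D \<Longrightarrow> riccati_residual U D T X \<in> block_shape U D"
  by (auto simp: block_shape_def riccati_residual_def matrix_mult_nth intro!: sum.neutral)

lemma riccati_fixpoint_iff:
  assumes "d \<noteq> 0"
  shows "quad_map (riccati_const U D d T) (riccati_lin U D d T) (riccati_quad U D d T) x = x \<longleftrightarrow>
    as_matrix x \<in> block_shape U D \<and> riccati_residual U D T (as_matrix x) = 0" (is "?l \<longleftrightarrow> ?r")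
proof
  assume l: ?l
  have eq: "x (i, j) = (if i \<in> U \<and> j \<in> D then x (i, j) + riccati_residual U D T (as_matrix x) $ i $ j / d else 0)" for i j
    using fun_cong[OF l, of "(i, j)"] by (simp add: riccati_quad_map)
  have "x (i, j) = 0" if "\<not> (i \<in> U \<and> j \<in> D)" for i j using eq[of i j] that by auto
  then have shape: "as_matrix x \<in> block_shape U D" by (simp add: block_shape_def as_matrix_def)
  have "riccati_residual U D T (as_matrix x) $ i $ j = 0" for i j
  proof (cases "i \<in> U \<and> j \<in> D")
    case True
    then show ?thesis using eq[of i j] assms by simp
  next
    case False
    then show ?thesis using riccati_residual_shape[OF shape, of T] by (auto simp: block_shape_def)
  qed
  with shape show ?r by (simp add: vec_eq_iff)
next
  assume r: ?r
  then have "x (i, j) = 0" if "\<not> (i \<in> U \<and> j \<in> D)" for i j using that by (auto simp: block_shape_def as_matrix_def)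
  with r show ?l by (auto simp: fun_eq_iff riccati_quad_map)
qed

text \<open>
  The part of the fluid model that the Riccati equation sees: \<open>T\<close> is the time-changed generator,
  \<open>U\<close> and \<open>D\<close> are the up and down phases.
\<close>

locale censored_flow =
  fixes U D :: "'s::finite set" and T :: "real^'s^'s"
  assumes disjoint: "U \<inter> D = {}"
    and nonneg: "\<And>i j. i \<noteq> j \<Longrightarrow> 0 \<le> T $ i $ j"
    and support: "T \<in> block_shape (U \<union> D) (U \<union> D)"
    and row_sum: "T *v 1 = 0"
begin

text \<open>
  The only coefficient that can be negative is the diagonal one of the linear part,
  \<open>1 + (T\<^sub>i\<^sub>i + T\<^sub>j\<^sub>j) / d\<close>.
\<close>

lemma riccati_coefficients_nonneg:
  assumes d: "0 < d" "\<And>i. - T $ i $ i \<le> d / 2"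
  shows "0 \<le> riccati_const U D d T p" "0 \<le> riccati_lin U D d T p q" "0 \<le> riccati_quad U D d T p q r"
proof -
  obtain i j k l m n where p: "p = (i, j)" and q: "q = (k, l)" and r: "r = (m, n)" by (metis surj_pair)
  have T: "0 \<le> T $ x $ y" if "x \<in> U" "y \<in> D" for x y using that disjoint by (intro nonneg) auto
  have T': "0 \<le> T $ x $ y" if "x \<in> D" "y \<in> U" for x y using that disjoint by (intro nonneg) auto
  show "0 \<le> riccati_const U D d T p" using d T by (simp add: riccati_const_def p)
  show "0 \<le> riccati_quad U D d T p q r" using d T' by (simp add: riccati_quad_def p q r)
  show "0 \<le> riccati_lin U D d T p q"
  proof (cases "k = i \<and> l = j \<and> i \<in> U \<and> j \<in> D")
    case True
    have "- (1 / 2) \<le> T $ i $ i / d" "- (1 / 2) \<le> T $ j $ j / d"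
      using d(1) d(2)[of i] d(2)[of j] by (simp_all add: pos_le_divide_eq)
    with True show ?thesis by (simp add: riccati_lin_def p q)
  next
    case False
    then show ?thesis using d(1) nonneg[of i k] nonneg[of l j] by (auto simp: riccati_lin_def p q)
  qed
qed

definition K :: "real^'s^'s \<Rightarrow> real^'s^'s" where
  "K X = block U U T + X ** block D U T"

lemma K_column_support: "j \<notin> U \<Longrightarrow> K X $ i $ j = 0"
  by (simp add: K_def matrix_mult_nth)

lemma K_nonneg:
  assumes "X \<in> block_shape U D" "0 \<le> X" "i \<noteq> j"
  shows "0 \<le> K X $ i $ j"
proof -
  have "0 \<le> X $ i $ l * block D U T $ l $ j" for l
    using assms disjoint by (cases "l \<in> D \<and> j \<in> U") (auto simp: less_eq_vec_def intro!: mult_nonneg_nonneg nonneg)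
  then show ?thesis using nonneg[OF assms(3)] by (simp add: K_def matrix_mult_nth sum_nonneg)
qed

lemma K_diagonal:
  assumes "X \<in> block_shape U D" "0 \<le> X" "i \<in> U"
  shows "T $ i $ i \<le> K X $ i $ i"
proof -
  have "0 \<le> X $ i $ l * block D U T $ l $ i" for l
    using assms disjoint by (cases "l \<in> D") (auto simp: less_eq_vec_def intro!: mult_nonneg_nonneg nonneg)
  then show ?thesis using assms(3) by (simp add: K_def matrix_mult_nth sum_nonneg)
qed

text \<open>
  For a solution \<open>X\<close> of the Riccati equation this is the identity
  \<open>K [1, - X] = [1, X] T\<close>, applied to \<open>g\<close>; it transports information on \<open>T\<close> to \<open>K\<close>.
\<close>

lemma K_intertwines:
  assumes X: "X \<in> block_shape U D" and i: "i \<in> U"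
  shows "(K X *v (g - X *v g)) $ i + (riccati_residual U D T X *v g) $ i = (T *v g) $ i + (X *v (T *v g)) $ i"
proof -
  have "K X *v (g - X *v g) + riccati_residual U D T X *v g
      = (block U U T + block U D T) *v g + X *v ((block D U T + block D D T) *v g)"
    by (simp add: K_def riccati_residual_def matrix_vector_mult_add_rdistrib matrix_vector_right_distrib
        matrix_vector_mult_diff_distrib matrix_vector_mul_assoc matrix_mult_simps)
  moreover have "((block U U T + block U D T) *v g) $ i = (T *v g) $ i"
    unfolding matrix_vector_nth using i support disjoint by (intro sum.cong) (auto simp: block_shape_def)
  moreover have "((block D U T + block D D T) *v g) $ l = (T *v g) $ l" if "l \<in> D" for l
    unfolding matrix_vector_nth using that support disjoint by (intro sum.cong) (auto simp: block_shape_def)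
  then have "(X *v ((block D U T + block D D T) *v g)) $ i = (X *v (T *v g)) $ i"
    unfolding matrix_vector_nth[of X] using X by (intro sum.cong) (auto simp: block_shape_def)
  ultimately show ?thesis by (metis vector_add_component)
qed

text \<open>
  The iteration from \<open>0\<close> preserves row sums at most \<open>1\<close>: by \<open>K_intertwines\<close> with \<open>g = 1\<close> the
  defect \<open>1 - X 1\<close> is multiplied by \<open>1 + K / d\<close>, whose entries are nonnegative. This gives at once
  the bound on the iterates and the bound on the limit.
\<close>

lemma substochastic_riccati_solution:
  obtains X where "X \<in> block_shape U D" "0 \<le> X" "\<And>i. (X *v 1) $ i \<le> 1" "riccati_residual U D T X = 0"
proof -
  define d where "d = 2 * (\<Sum>i\<in>UNIV. \<bar>T $ i $ i\<bar>) + 1"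
  have d0: "0 < d" by (simp add: d_def add_nonneg_pos sum_nonneg)
  have d: "- T $ i $ i \<le> d / 2" for i
    using member_le_sum[of i UNIV "\<lambda>i. \<bar>T $ i $ i\<bar>"] by (simp add: d_def)
  note nn = riccati_coefficients_nonneg[OF d0 d]
  define G where "G = quad_map (riccati_const U D d T) (riccati_lin U D d T) (riccati_quad U D d T)"
  have inv: "as_matrix ((G ^^ n) (\<lambda>_. 0)) \<in> block_shape U D \<and> (\<forall>p. 0 \<le> (G ^^ n) (\<lambda>_. 0) p)
      \<and> (\<forall>i. (as_matrix ((G ^^ n) (\<lambda>_. 0)) *v 1) $ i \<le> 1)" for n
  proof (induction n)
    case 0
    then show ?case by (simp add: block_shape_def as_matrix_def matrix_vector_nth)
  next
    case (Suc n)
    define x where "x = (G ^^ n) (\<lambda>_. 0)"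
    define X where "X = as_matrix x"
    from Suc have x: "\<And>p. 0 \<le> x p" and X: "X \<in> block_shape U D" "\<And>i. (X *v 1) $ i \<le> 1"
      by (auto simp: x_def X_def)
    have X0: "0 \<le> X" using x by (simp add: X_def as_matrix_def less_eq_vec_def)
    have G: "G x (i, j) = (if i \<in> U \<and> j \<in> D then X $ i $ j + riccati_residual U D T X $ i $ j / d else 0)" for i j
      by (simp add: G_def riccati_quad_map X_def) (simp add: as_matrix_def)
    have "as_matrix (G x) = X + (1 / d) *\<^sub>R riccati_residual U D T X"
      using X(1) riccati_residual_shape[OF X(1), of T]
      by (simp add: vec_eq_iff as_matrix_def G) (simp add: block_shape_def)
    then have row: "(as_matrix (G x) *v 1) $ i = (X *v 1) $ i + (riccati_residual U D T X *v 1) $ i / d" for i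
      by (simp add: matrix_vector_mult_add_rdistrib scaleR_matrix_vector_assoc[symmetric])
    have "(as_matrix (G x) *v 1) $ i \<le> 1" for i
    proof (cases "i \<in> U")
      case True
      have "- d * (1 - X *v 1) $ i \<le> T $ i $ i * (1 - X *v 1) $ i"
        using X(2)[of i] d[of i] d0 by (intro mult_right_mono) auto
      also have "\<dots> \<le> K X $ i $ i * (1 - X *v 1) $ i"
        using K_diagonal[OF X(1) X0 True] X(2)[of i] by (intro mult_right_mono) auto
      also have "\<dots> \<le> (\<Sum>j\<in>UNIV. K X $ i $ j * (1 - X *v 1) $ j)"
      proof -
        have "(\<Sum>j\<in>UNIV. K X $ i $ j * (1 - X *v 1) $ j) = K X $ i $ i * (1 - X *v 1) $ i
            + (\<Sum>j\<in>UNIV - {i}. K X $ i $ j * (1 - X *v 1) $ j)" by (simp add: sum.remove)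
        moreover have "0 \<le> (\<Sum>j\<in>UNIV - {i}. K X $ i $ j * (1 - X *v 1) $ j)"
          using X(2) K_nonneg[OF X(1) X0] by (intro sum_nonneg mult_nonneg_nonneg) auto
        ultimately show ?thesis by simp
      qed
      also have "\<dots> = (K X *v (1 - X *v 1)) $ i" by (simp add: matrix_vector_nth[of "K X"])
      also have "\<dots> = - (riccati_residual U D T X *v 1) $ i"
        using K_intertwines[OF X(1) True, of 1] by (simp add: row_sum)
      finally have "(riccati_residual U D T X *v 1) $ i \<le> d * (1 - (X *v 1) $ i)" by simp
      then have "(riccati_residual U D T X *v 1) $ i / d \<le> 1 - (X *v 1) $ i"
        using d0 by (simp add: pos_divide_le_eq mult.commute)
      then show ?thesis by (simp add: row)
    next
      case False
      then show ?thesis by (simp add: matrix_vector_nth as_matrix_def G)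
    qed
    moreover have "0 \<le> G x p" for p unfolding G_def by (intro quad_map_nonneg nn x)
    moreover have "as_matrix (G x) \<in> block_shape U D" by (simp add: block_shape_def as_matrix_def G)
    ultimately show ?case by (simp add: x_def)
  qed
  have bound: "(G ^^ n) (\<lambda>_. 0) p \<le> 1" for n p
  proof -
    obtain i j where p: "p = (i, j)" by fastforce
    have "(G ^^ n) (\<lambda>_. 0) p \<le> (\<Sum>j\<in>UNIV. (G ^^ n) (\<lambda>_. 0) (i, j))"
      unfolding p using inv[of n] by (intro member_le_sum) auto
    also have "\<dots> \<le> 1" using inv[of n] by (simp add: matrix_vector_nth as_matrix_def)
    finally show ?thesis .
  qed
  obtain y where y: "\<And>p. (\<lambda>n. (G ^^ n) (\<lambda>_. 0) p) \<longlonglongrightarrow> y p"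
    and least: "least_fixpoint (riccati_const U D d T) (riccati_lin U D d T) (riccati_quad U D d T) y"
    using quad_map_iterates_limit[OF nn bound[unfolded G_def]] unfolding G_def by blast
  show thesis
  proof (rule that[of "as_matrix y"])
    show "as_matrix y \<in> block_shape U D" "riccati_residual U D T (as_matrix y) = 0"
      using least d0 riccati_fixpoint_iff[of d U D T y] by (auto simp: least_fixpoint_def)
    show "0 \<le> as_matrix y" using least by (simp add: least_fixpoint_def as_matrix_def less_eq_vec_def)
    show "(as_matrix y *v 1) $ i \<le> 1" for i
    proof (rule LIMSEQ_le_const2)
      show "(\<lambda>n. (as_matrix ((G ^^ n) (\<lambda>_. 0)) *v 1) $ i) \<longlonglongrightarrow> (as_matrix y *v 1) $ i"
        unfolding matrix_vector_nth as_matrix_def by (auto intro!: tendsto_intros y)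
    qed (use inv in auto)
  qed
qed

end


section \<open>Negative drift makes the Riccati equation subcritical\<close>

text \<open>
  The set of parameters at which all components are positive is open and, by \<open>step\<close>, also closed
  in the half-line.
\<close>

lemma positive_throughout:
  fixes k :: "real \<Rightarrow> 'i::finite \<Rightarrow> real"
  assumes cont: "\<And>i. continuous_on {0<..} (\<lambda>t. k t i)"
    and start: "0 < t0" "\<And>i. i \<in> U \<Longrightarrow> 0 < k t0 i"
    and step: "\<And>t i. 0 < t \<Longrightarrow> (\<And>j. j \<in> U \<Longrightarrow> 0 \<le> k t j) \<Longrightarrow> i \<in> U \<Longrightarrow> 0 < k t i"
    and t: "0 < t" and i: "i \<in> U"
  shows "0 < k t i"
proof -
  define P where "P = {t \<in> {0<..}. \<forall>j\<in>U. 0 < k t j}"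
  have P1: "P = \<Inter> ((\<lambda>j. {0<..} \<inter> (\<lambda>t. k t j) -` {0<..}) ` U)" using i by (auto simp: P_def)
  have P2: "P = {0<..} \<inter> (\<Inter>j\<in>U. {0<..} \<inter> (\<lambda>t. k t j) -` {0..})"
  proof (intro equalityI subsetI)
    fix t assume "t \<in> {0<..} \<inter> (\<Inter>j\<in>U. {0<..} \<inter> (\<lambda>t. k t j) -` {0..})"
    then have "0 < t" "\<And>j. j \<in> U \<Longrightarrow> 0 \<le> k t j" unfolding Int_iff INT_iff vimage_eq by auto
    then show "t \<in> P" using step by (simp add: P_def)
  qed (auto simp: P_def less_imp_le)
  have "openin (top_of_set {0<..}) P"
    unfolding P1
  proof (rule openin_Inter)
    fix V assume "V \<in> (\<lambda>j. {0<..} \<inter> (\<lambda>t. k t j) -` {0<..}) ` U"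
    then show "openin (top_of_set {0<..}) V" by (auto intro!: continuous_openin_preimage_gen cont)
  qed (use i in auto)
  moreover have "closedin (top_of_set {0<..}) P"
  proof (cases "U = {}")
    case False
    then show ?thesis unfolding P2
      by (intro closedin_Int closedin_INT continuous_closedin_preimage cont) auto
  qed (auto simp: P2)
  ultimately have "P = {} \<or> P = {0<..}"
    using connected_clopen[of "{0::real<..}"] by simp
  moreover have "t0 \<in> P" using start by (simp add: P_def)
  ultimately have "t \<in> P" using t by auto
  then show ?thesis using i by (simp add: P_def)
qed

context censored_flow
begin

text \<open>
  At a zero of a nonnegative vector the product with a matrix with nonnegative off-diagonal
  entries is nonnegative.
\<close>

lemma K_supersolution_positive:
  assumes X: "X \<in> block_shape U D" "0 \<le> X" and i: "i \<in> U"
    and x: "\<And>j. j \<in> U \<Longrightarrow> 0 \<le> x $ j" and less: "(K X *v x) $ i < l * x $ i"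
  shows "0 < x $ i"
proof (rule ccontr)
  assume "\<not> 0 < x $ i"
  then have 0: "x $ i = 0" using x[OF i] by simp
  have "0 \<le> K X $ i $ j * x $ j" for j
    using 0 K_column_support[of j X i] K_nonneg[OF X, of i j] x[of j]
    by (cases "j = i"; cases "j \<in> U") auto
  then have "0 \<le> (K X *v x) $ i" by (simp add: matrix_vector_nth sum_nonneg)
  with less 0 show False by simp
qed

text \<open>
  For a shift \<open>l\<close> beyond the row sums of \<open>K\<close> the matrix \<open>l - K\<close> is diagonally dominant; the
  inequality fails at a minimal component unless that component is positive.
\<close>

lemma K_large_shift_positive:
  assumes X: "X \<in> block_shape U D" "0 \<le> X"
    and less: "\<And>i. i \<in> U \<Longrightarrow> (K X *v x) $ i < l * x $ i"
    and l: "\<And>i. i \<in> U \<Longrightarrow> (\<Sum>j\<in>U. K X $ i $ j) < l" and i: "i \<in> U"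
  shows "0 < x $ i"
proof -
  define m where "m = Min (($) x ` U)"
  have m_le: "m \<le> x $ j" if "j \<in> U" for j using that by (simp add: m_def)
  have "m \<in> ($) x ` U" unfolding m_def using i by (intro Min_in) auto
  then obtain i0 where i0: "i0 \<in> U" "x $ i0 = m" by auto
  have "0 < m"
  proof (rule ccontr)
    assume "\<not> 0 < m"
    then have m: "m \<le> 0" by simp
    have "l * m \<le> (\<Sum>j\<in>U. K X $ i0 $ j) * m" using l[OF i0(1)] m by (intro mult_right_mono_neg) auto
    also have "\<dots> = (\<Sum>j\<in>U. K X $ i0 $ j * m)" by (rule sum_distrib_right)
    also have "\<dots> \<le> (\<Sum>j\<in>U. K X $ i0 $ j * x $ j)"
    proof (rule sum_mono)
      fix j assume "j \<in> U"
      then show "K X $ i0 $ j * m \<le> K X $ i0 $ j * x $ j"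
        using i0 m_le K_nonneg[OF X, of i0 j] by (cases "j = i0") (auto intro: mult_left_mono)
    qed
    also have "\<dots> = (K X *v x) $ i0"
      unfolding matrix_vector_nth by (rule sum.mono_neutral_left) (auto simp: K_column_support)
    also have "\<dots> < l * m" using less[OF i0(1)] i0 by simp
    finally show False by simp
  qed
  with m_le[OF i] show ?thesis by simp
qed

text \<open>
  Jensen's inequality in the form \<open>exp z \<ge> 1 + z\<close>; the row sums \<open>0\<close> remove the constant term.
\<close>

lemma exp_drift:
  assumes i: "i \<in> U \<union> D" and l: "0 < l" and h: "a < (T *v h) $ i"
  shows "l * a * exp (l * h $ i) < (T *v (\<chi> j. exp (l * h $ j))) $ i"
proof -
  let ?g = "\<lambda>j. exp (l * h $ j)"
  have row: "(\<Sum>j\<in>UNIV. T $ i $ j) = 0" using row_sum matrix_vector_nth[of T 1 i] by simp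
  have "l * a * ?g i < l * (T *v h) $ i * ?g i" using l h by (simp add: mult_strict_left_mono)
  also have "\<dots> = (\<Sum>j\<in>UNIV. T $ i $ j * (?g i * (1 + l * (h $ j - h $ i))))"
  proof -
    have "T $ i $ j * (?g i * (1 + l * (h $ j - h $ i)))
        = ?g i * (1 - l * h $ i) * T $ i $ j + ?g i * l * (T $ i $ j * h $ j)" for j
      by (simp add: algebra_simps)
    then have "(\<Sum>j\<in>UNIV. T $ i $ j * (?g i * (1 + l * (h $ j - h $ i))))
        = ?g i * (1 - l * h $ i) * (\<Sum>j\<in>UNIV. T $ i $ j) + ?g i * l * (\<Sum>j\<in>UNIV. T $ i $ j * h $ j)"
      by (simp only: sum.distrib sum_distrib_left)
    then show ?thesis by (simp add: row matrix_vector_nth)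
  qed
  also have "\<dots> \<le> (\<Sum>j\<in>UNIV. T $ i $ j * ?g j)"
  proof (rule sum_mono)
    fix j
    show "T $ i $ j * (?g i * (1 + l * (h $ j - h $ i))) \<le> T $ i $ j * ?g j"
    proof (cases "i = j")
      case False
      have "?g i * (1 + l * (h $ j - h $ i)) \<le> ?g i * exp (l * (h $ j - h $ i))"
        by (intro mult_left_mono exp_ge_add_one_self) simp
      also have "\<dots> = ?g j" by (simp add: algebra_simps flip: exp_add)
      finally show ?thesis by (intro mult_left_mono nonneg[OF False])
    qed simp
  qed
  finally show ?thesis by (simp add: matrix_vector_nth)
qed

text \<open>
  With \<open>g\<^sub>t = exp (t h)\<close> the vectors \<open>k\<^sub>t = X g\<^sub>t - g\<^sub>t\<close> are positive on \<open>U\<close> for all \<open>t > 0\<close>. Their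
  limit \<open>X 1 - 1\<close> as \<open>t\<close> tends to \<open>0\<close> is thus nonnegative, so \<open>X\<close> is stochastic, and the
  derivative \<open>X h - h\<close> at \<open>0\<close> is nonnegative and the vector wanted.
\<close>

lemma K_stable:
  assumes X: "X \<in> block_shape U D" "0 \<le> X" and sub: "\<And>i. (X *v 1) $ i \<le> 1"
    and sol: "riccati_residual U D T X = 0"
    and up: "\<And>i. i \<in> U \<Longrightarrow> 1 < (T *v h) $ i" and down: "\<And>i. i \<in> D \<Longrightarrow> - 1 < (T *v h) $ i"
  obtains k where "\<And>i. i \<in> U \<Longrightarrow> 0 < k $ i" "\<And>i. i \<in> U \<Longrightarrow> (K X *v k) $ i < 0"
proof -
  define g where "g t = (\<chi> j. exp (t * h $ j))" for t
  define k where "k t = X *v g t - g t" for t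
  have k_nth: "k t $ i = (\<Sum>l\<in>UNIV. X $ i $ l * exp (t * h $ l)) - exp (t * h $ i)" for t i
    by (simp add: k_def matrix_vector_nth g_def)
  have X_nn: "0 \<le> X $ i $ l" for i l using X(2) by (simp add: less_eq_vec_def)
  have X_0: "X $ i $ l = 0" if "l \<notin> D" for i l using X(1) that by (simp add: block_shape_def)
  have intertwine: "(K X *v (X *v y - y)) $ i = - (T *v y) $ i - (X *v (T *v y)) $ i" if "i \<in> U" for y i
  proof -
    have "K X *v (X *v y - y) = - (K X *v (y - X *v y))" by (simp add: matrix_vector_mult_diff_distrib)
    then show ?thesis using K_intertwines[OF X(1) that, of y] by (simp add: sol)
  qed
  \<comment> \<open>the two signs of the drift turn into one inequality for \<open>K\<close>, as \<open>k t\<close> is minus the up part of \<open>g t - X g t\<close>\<close>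
  have K_less: "(K X *v k t) $ i < t * k t $ i" if t: "0 < t" and i: "i \<in> U" for t i
  proof -
    have "t * g t $ i < (T *v g t) $ i" using exp_drift[of i t 1 h] t i up by (simp add: g_def)
    moreover have "- (t * (X *v g t) $ i) \<le> (X *v (T *v g t)) $ i"
    proof -
      have "X $ i $ l * (- t * g t $ l) \<le> X $ i $ l * (T *v g t) $ l" for l
      proof (cases "l \<in> D")
        case True
        then have "- t * g t $ l < (T *v g t) $ l" using exp_drift[of l t "- 1" h] t down by (simp add: g_def)
        then show ?thesis by (intro mult_left_mono X_nn) simp
      qed (simp add: X_0)
      then have "(\<Sum>l\<in>UNIV. X $ i $ l * (- t * g t $ l)) \<le> (\<Sum>l\<in>UNIV. X $ i $ l * (T *v g t) $ l)"
        by (rule sum_mono)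
      then show ?thesis by (simp add: matrix_vector_nth[of X] sum_distrib_left sum_negf mult_ac)
    qed
    ultimately show ?thesis using intertwine[OF i, of "g t"] by (simp add: k_def algebra_simps)
  qed
  have k_pos: "0 < k t $ i" if "0 < t" "i \<in> U" for t i
  proof (rule positive_throughout[where k = "\<lambda>t i. k t $ i" and U = U])
    define t0 where "t0 = 1 + (\<Sum>i\<in>UNIV. \<bar>\<Sum>j\<in>U. K X $ i $ j\<bar>)"
    have t0: "(\<Sum>j\<in>U. K X $ i $ j) < t0" for i
      using member_le_sum[of i UNIV "\<lambda>i. \<bar>\<Sum>j\<in>U. K X $ i $ j\<bar>"] by (simp add: t0_def)
    show t0_pos: "0 < t0" by (simp add: t0_def add_pos_nonneg sum_nonneg)
    show "0 < k t0 $ i" if "i \<in> U" for i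
      by (rule K_large_shift_positive[OF X K_less[OF t0_pos] t0 that])
    show "continuous_on {0<..} (\<lambda>t. k t $ i)" for i unfolding k_nth by (intro continuous_intros)
    show "0 < k t $ i" if "0 < t" "\<And>j. j \<in> U \<Longrightarrow> 0 \<le> k t $ j" "i \<in> U" for t i
      using K_supersolution_positive[OF X that(3,2) K_less[OF that(1,3)]] .
  qed (use that in auto)
  have X_row: "(\<Sum>l\<in>UNIV. X $ i $ l) = 1" if i: "i \<in> U" for i
  proof (rule antisym)
    show "(\<Sum>l\<in>UNIV. X $ i $ l) \<le> 1" using sub[of i] by (simp add: matrix_vector_nth)
    have "((\<lambda>t. k t $ i) \<longlongrightarrow> (\<Sum>l\<in>UNIV. X $ i $ l * exp (0 * h $ l)) - exp (0 * h $ i)) (at_right 0)"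
      unfolding k_nth by (intro tendsto_intros)
    moreover have "\<forall>\<^sub>F t in at_right 0. 0 \<le> k t $ i"
      using eventually_at_right_less by eventually_elim (rule less_imp_le[OF k_pos[OF _ i]])
    ultimately have "0 \<le> (\<Sum>l\<in>UNIV. X $ i $ l * exp (0 * h $ l)) - exp (0 * h $ i)"
      by (rule tendsto_lowerbound) simp
    then show "1 \<le> (\<Sum>l\<in>UNIV. X $ i $ l)" by simp
  qed
  define k0 where "k0 = X *v h - h"
  have k0_nn: "0 \<le> k0 $ i" if i: "i \<in> U" for i
  proof -
    have "((\<lambda>t. k t $ i) has_field_derivative (\<Sum>l\<in>UNIV. X $ i $ l * h $ l) - h $ i) (at 0)"
      unfolding k_nth by (auto intro!: derivative_eq_intros simp: mult_ac)
    then have "((\<lambda>t. (k t $ i - k 0 $ i) / (t - 0)) \<longlongrightarrow> k0 $ i) (at 0)"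
      by (simp add: has_field_derivative_iff k0_def matrix_vector_nth)
    moreover have "k 0 $ i = 0" by (simp add: k_nth X_row i)
    ultimately have "((\<lambda>t. k t $ i / t) \<longlongrightarrow> k0 $ i) (at 0)" by simp
    then have "((\<lambda>t. k t $ i / t) \<longlongrightarrow> k0 $ i) (at_right 0)"
      by (rule tendsto_within_subset) simp
    moreover have "\<forall>\<^sub>F t in at_right 0. 0 \<le> k t $ i / t"
      using eventually_at_right_less
      by eventually_elim (intro divide_nonneg_nonneg less_imp_le[OF k_pos[OF _ i]], simp_all)
    ultimately show ?thesis by (rule tendsto_lowerbound) simp
  qed
  have K0: "(K X *v k0) $ i < 0 * k0 $ i" if i: "i \<in> U" for i
  proof -
    have "- 1 = (\<Sum>l\<in>UNIV. X $ i $ l * (- 1))" using X_row[OF i] by (simp add: sum_negf)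
    also have "\<dots> \<le> (\<Sum>l\<in>UNIV. X $ i $ l * (T *v h) $ l)"
    proof (rule sum_mono)
      fix l
      show "X $ i $ l * - 1 \<le> X $ i $ l * (T *v h) $ l"
      proof (cases "l \<in> D")
        case True
        show ?thesis by (rule mult_left_mono[OF less_imp_le[OF down[OF True]] X_nn])
      qed (simp add: X_0)
    qed
    finally have "- 1 \<le> (X *v (T *v h)) $ i" by (simp add: matrix_vector_nth[of X])
    then show ?thesis using intertwine[OF i, of h] up[OF i] by (simp add: k0_def)
  qed
  show thesis
  proof (rule that[of k0])
    fix i assume i: "i \<in> U"
    show "0 < k0 $ i" by (rule K_supersolution_positive[OF X i k0_nn K0[OF i]])
    show "(K X *v k0) $ i < 0" using K0[OF i] by simp
  qed
qed

text \<open>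
  For \<open>Y \<ge> 0\<close> with \<open>Y \<le> P Y\<close> the row sums \<open>r = Y 1\<close> satisfy \<open>K r \<ge> 0\<close>, as \<open>X 1 \<le> 1\<close> makes the
  row sums of \<open>T\<^sub>-\<^sub>- + T\<^sub>-\<^sub>+ X\<close> nonpositive. Comparing \<open>r\<close> with multiples of \<open>k\<close> gives \<open>r = 0\<close>.
  Hence \<open>strict_superharmonic_exists\<close> applies.
\<close>

lemma riccati_subcritical:
  assumes X: "X \<in> block_shape U D" "0 \<le> X" and sub: "\<And>i. (X *v 1) $ i \<le> 1"
    and k: "\<And>i. i \<in> U \<Longrightarrow> 0 < k $ i" "\<And>i. i \<in> U \<Longrightarrow> (K X *v k) $ i < 0"
    and d: "0 < d" "\<And>i. - T $ i $ i \<le> d / 2"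
  obtains w where "\<And>p. 0 < w p"
    "\<And>p. (\<Sum>q\<in>UNIV. quad_slope (riccati_lin U D d T) (riccati_quad U D d T)
        (\<lambda>(i, j). X $ i $ j) (\<lambda>(i, j). X $ i $ j) p q * w q) < w p"
proof -
  define P where "P = quad_slope (riccati_lin U D d T) (riccati_quad U D d T) (\<lambda>(i, j). X $ i $ j) (\<lambda>(i, j). X $ i $ j)"
  have X_as: "as_matrix (\<lambda>(i, j). X $ i $ j) = X" by (simp add: as_matrix_def vec_eq_iff)
  have X_nn: "0 \<le> X $ i $ j" for i j using X(2) by (simp add: less_eq_vec_def)
  have P_nn: "0 \<le> P p q" for p q
    unfolding P_def by (intro quad_slope_nonneg riccati_coefficients_nonneg[OF d]) (simp_all add: split_beta X_nn)
  have zero: "\<forall>p. x p = 0" if x: "\<And>p. 0 \<le> x p" and le: "\<And>p. x p \<le> (\<Sum>q\<in>UNIV. P p q * x q)" for x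
  proof -
    define Y where "Y = as_matrix x"
    have Y_nth: "Y $ i $ j = x (i, j)" for i j by (simp add: Y_def as_matrix_def)
    have le': "x (i, j) \<le> (if i \<in> U \<and> j \<in> D then x (i, j) +
       (K X ** Y + Y ** (block D D T + block D U T ** X)) $ i $ j / d else 0)" for i j
      using le[of "(i, j)"] unfolding P_def riccati_slope_sum X_as by (simp only: K_def Y_def)
    have out: "x (i, j) = 0" if "\<not> (i \<in> U \<and> j \<in> D)" for i j
      using le'[of i j] x[of "(i, j)"] that by auto
    have Kx: "0 \<le> (K X ** Y + Y ** (block D D T + block D U T ** X)) $ i $ j" if "i \<in> U" "j \<in> D" for i j
    proof -
      have "0 \<le> (K X ** Y + Y ** (block D D T + block D U T ** X)) $ i $ j / d" using le'[of i j] that by simp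
      then show ?thesis using d(1) by (simp add: zero_le_divide_iff)
    qed
    define r where "r = Y *v 1"
    have r_nn: "0 \<le> r $ i" for i by (simp add: r_def matrix_vector_nth Y_nth x sum_nonneg)
    have Kr: "0 \<le> (K X *v r) $ i" if i: "i \<in> U" for i
    proof -
      have "0 \<le> (\<Sum>j\<in>D. (K X ** Y + Y ** (block D D T + block D U T ** X)) $ i $ j)"
        using Kx[OF i] by (intro sum_nonneg) auto
      also have "\<dots> = ((K X ** Y + Y ** (block D D T + block D U T ** X)) *v 1) $ i"
        unfolding matrix_vector_nth one_index mult_1_right
        by (rule sum.mono_neutral_left) (use X(1) in \<open>auto simp: matrix_mult_nth Y_nth out block_shape_def\<close>)
      also have "\<dots> = (K X *v r) $ i + (Y *v ((block D D T + block D U T ** X) *v 1)) $ i"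
        by (simp only: r_def matrix_vector_mult_add_rdistrib[of "K X ** Y"] matrix_vector_mul_assoc vector_add_component)
      also have "(Y *v ((block D D T + block D U T ** X) *v 1)) $ i \<le> 0"
      proof -
        have "((block D D T + block D U T ** X) *v 1) $ l \<le> 0" if l: "l \<in> D" for l
        proof -
          have "(block D U T *v (X *v 1)) $ l \<le> (block D U T *v 1) $ l"
            unfolding matrix_vector_nth[of "block D U T"]
            using disjoint l sub by (intro sum_mono mult_left_mono) (auto intro!: nonneg)
          moreover have "(block D D T *v 1) $ l + (block D U T *v 1) $ l = (T *v 1) $ l"
            unfolding matrix_vector_nth sum.distrib[symmetric]
            using l support disjoint by (intro sum.cong) (auto simp: block_shape_def)
          ultimately show ?thesis
            by (simp add: matrix_vector_mult_add_rdistrib matrix_vector_mul_assoc row_sum)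
        qed
        then have "Y $ i $ l * ((block D D T + block D U T ** X) *v 1) $ l \<le> 0" for l
          using x[of "(i, l)"] by (cases "l \<in> D") (auto simp: Y_nth out mult_nonneg_nonpos)
        then show ?thesis by (simp add: matrix_vector_nth[of Y] sum_nonpos)
      qed
      finally show ?thesis by simp
    qed
    have r_0: "r $ i = 0" if i: "i \<in> U" for i
    proof -
      define t where "t = Max ((\<lambda>i. r $ i / k $ i) ` U)"
      have "r $ j / k $ j \<le> t" if "j \<in> U" for j using that by (simp add: t_def)
      then have le: "r $ j \<le> t * k $ j" if "j \<in> U" for j using that k(1)[of j] by (simp flip: pos_divide_le_eq)
      have "t \<in> (\<lambda>i. r $ i / k $ i) ` U" unfolding t_def using i by (intro Max_in) auto
      then obtain m where m: "m \<in> U" "t = r $ m / k $ m" by auto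
      have "t \<le> 0"
      proof (rule ccontr)
        assume "\<not> t \<le> 0"
        then have t: "0 < t" by simp
        have "(K X *v (t *\<^sub>R k - r)) $ m = t * (K X *v k) $ m - (K X *v r) $ m"
          by (simp add: matrix_vector_mult_diff_distrib matrix_vector_mult_scaleR)
        also have "\<dots> < 0 * (t *\<^sub>R k - r) $ m"
          using Kr[OF m(1)] mult_pos_neg[OF t k(2)[OF m(1)]] by simp
        finally have neg: "(K X *v (t *\<^sub>R k - r)) $ m < 0 * (t *\<^sub>R k - r) $ m" .
        have "0 < (t *\<^sub>R k - r) $ m"
          by (rule K_supersolution_positive[OF X m(1) _ neg]) (use le in simp)
        then show False using m k(1)[OF m(1)] by simp
      qed
      then have "t * k $ i \<le> 0" using k(1)[OF i] by (simp add: mult_nonpos_nonneg)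
      then show ?thesis using le[OF i] r_nn[of i] by simp
    qed
    have "x (i, j) = 0" for i j
    proof (cases "i \<in> U")
      case True
      then have "(\<Sum>j\<in>UNIV. x (i, j)) = 0" using r_0 by (simp add: r_def matrix_vector_nth Y_nth)
      then show ?thesis using x by (simp add: sum_nonneg_eq_0_iff)
    qed (simp add: out)
    then show ?thesis by auto
  qed
  show thesis
  proof (rule strict_superharmonic_exists[of P])
    show "\<forall>p. x p = 0" if "\<And>p. 0 \<le> x p" "\<And>p. x p \<le> (\<Sum>q\<in>UNIV. P p q * x q)" for x
      using that by (rule zero)
  next
    fix w assume "\<And>p. 0 < w p" "\<And>p. (\<Sum>q\<in>UNIV. P p q * w q) < w p"
    then show thesis unfolding P_def by (rule that)
  qed (rule P_nn)
qed

end


section \<open>Perturbation of the first return probabilities\<close>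

lemma block_inv_rate_matrix:
  assumes "\<And>i. i \<in> I \<Longrightarrow> c $ i \<noteq> 0"
  shows "block_inv I (block I I (rate_matrix c)) = (\<chi> i j. if i = j \<and> i \<in> I then 1 / c $ i else 0)" (is "_ = ?N")
proof (rule block_inv_eqI)
  have "block I I (rate_matrix c) $ i $ k * ?N $ k $ j = (if k = i then block I I (mat 1) $ i $ j else 0)"
    "?N $ i $ k * block I I (rate_matrix c) $ k $ j = (if k = i then block I I (mat 1) $ i $ j else 0)" for i j k
    using assms by (auto simp: rate_matrix_def mat_def)
  then show "block I I (rate_matrix c) ** ?N = block I I (mat 1)" "?N ** block I I (rate_matrix c) = block I I (mat 1)"
    by (simp_all only: vec_eq_iff matrix_mult_nth) simp_all
qed (auto simp: block_shape_def)

lemma C_up_inv_nth: "C_up_inv c $ i $ j = (if i = j \<and> i \<in> up_phases c then 1 / c $ i else 0)"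
  unfolding C_up_inv_def by (subst block_inv_rate_matrix) (auto simp: up_phases_def)

lemma abs_C_down_inv_nth: "abs_C_down_inv c $ i $ j = (if i = j \<and> i \<in> down_phases c then 1 / \<bar>c $ i\<bar> else 0)"
  unfolding abs_C_down_inv_def by (subst block_inv_rate_matrix) (auto simp: down_phases_def abs_entries_def)

lemma C_up_inv_mult_block:
  "C_up_inv c ** block (up_phases c) J (fluid_Q c A) = block (up_phases c) J (time_changed c A)"
proof -
  have "C_up_inv c $ i $ k * x = (if k = i then (if i \<in> up_phases c then x / \<bar>c $ i\<bar> else 0) else 0)" for i k x
    by (auto simp: C_up_inv_nth up_phases_def)
  then show ?thesis by (auto simp: vec_eq_iff matrix_mult_nth time_changed_def simp del: block_nth) simp_all
qed

lemma abs_C_down_inv_mult_block: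
  "abs_C_down_inv c ** block (down_phases c) J (fluid_Q c A) = block (down_phases c) J (time_changed c A)"
proof -
  have "abs_C_down_inv c $ i $ k * x = (if k = i then (if i \<in> down_phases c then x / \<bar>c $ i\<bar> else 0) else 0)" for i k x
    by (auto simp: abs_C_down_inv_nth)
  then show ?thesis by (auto simp: vec_eq_iff matrix_mult_nth time_changed_def simp del: block_nth) simp_all
qed

lemma riccati_solution_iff:
  "riccati_solution c A X \<longleftrightarrow> X \<in> block_shape (up_phases c) (down_phases c) \<and> 0 \<le> X \<and>
     riccati_residual (up_phases c) (down_phases c) (time_changed c A) X = 0"
  by (simp add: riccati_solution_def riccati_residual_def C_up_inv_mult_block abs_C_down_inv_mult_block
      flip: matrix_mul_assoc[of X "abs_C_down_inv c"])

text \<open>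
  Nonnegative solutions of the Riccati equation and nonnegative fixed points correspond to each
  other with their order, which also justifies the definite description in \<open>fluid_Psi\<close>.
\<close>

lemma fluid_Psi_eq_least_fixpoint:
  assumes "d \<noteq> 0"
    and least: "least_fixpoint (riccati_const (up_phases c) (down_phases c) d (time_changed c A))
      (riccati_lin (up_phases c) (down_phases c) d (time_changed c A))
      (riccati_quad (up_phases c) (down_phases c) d (time_changed c A)) y"
  shows "fluid_Psi c A = as_matrix y" and "riccati_solution c A (fluid_Psi c A)"
proof -
  have sol: "riccati_solution c A (as_matrix y)"
  proof -
    have "as_matrix y \<in> block_shape (up_phases c) (down_phases c)
        \<and> riccati_residual (up_phases c) (down_phases c) (time_changed c A) (as_matrix y) = 0"
      by (subst riccati_fixpoint_iff[OF assms(1), symmetric]) (use least in \<open>simp add: least_fixpoint_def\<close>)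
    moreover have "0 \<le> as_matrix y" using least by (simp add: least_fixpoint_def less_eq_vec_def as_matrix_def)
    ultimately show ?thesis by (simp add: riccati_solution_iff)
  qed
  have le: "as_matrix y \<le> Y" if Y: "riccati_solution c A Y" for Y
  proof -
    let ?x = "\<lambda>(i, j). Y $ i $ j"
    have "as_matrix ?x = Y" by (simp add: as_matrix_def vec_eq_iff)
    then have "quad_map (riccati_const (up_phases c) (down_phases c) d (time_changed c A))
      (riccati_lin (up_phases c) (down_phases c) d (time_changed c A))
      (riccati_quad (up_phases c) (down_phases c) d (time_changed c A)) ?x = ?x"
      using Y by (subst riccati_fixpoint_iff[OF assms(1)]) (simp add: riccati_solution_iff)
    moreover have "\<forall>p. 0 \<le> ?x p" using Y by (simp add: riccati_solution_iff less_eq_vec_def)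
    ultimately have "\<forall>p. y p \<le> ?x p" using least unfolding least_fixpoint_def by blast
    then show ?thesis by (simp add: less_eq_vec_def as_matrix_def)
  qed
  show "fluid_Psi c A = as_matrix y"
    unfolding fluid_Psi_def by (rule the_equality) (use sol le in \<open>auto intro: antisym\<close>)
  with sol show "riccati_solution c A (fluid_Psi c A)" by simp
qed

lemma fluid_Q_shape:
  "fluid_Q c A \<in> block_shape (up_phases c \<union> down_phases c) (up_phases c \<union> down_phases c)"
  by (auto simp: fluid_Q_def Let_def block_shape_def matrix_mult_nth intro!: sum.neutral)

lemma censored_flow_time_changed:
  assumes gen: "generator A" "irreducible_matrix A" and c: "c \<noteq> 0"
  shows "censored_flow (up_phases c) (down_phases c) (time_changed c A)"
proof
  show "up_phases c \<inter> down_phases c = {}" by (auto simp: up_phases_def down_phases_def)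
  show shape: "time_changed c A \<in> block_shape (up_phases c \<union> down_phases c) (up_phases c \<union> down_phases c)"
    using fluid_Q_shape[of c A] by (auto simp: block_shape_def time_changed_def)
  show "time_changed c A *v 1 = 0" by (rule time_changed_row_sum[OF gen c])
  fix i j :: 'a assume "i \<noteq> j"
  show "0 \<le> time_changed c A $ i $ j"
  proof (cases "c $ i \<noteq> 0 \<and> c $ j \<noteq> 0")
    case True
    then show ?thesis by (intro time_changed_nonneg[OF gen c] \<open>i \<noteq> j\<close>) auto
  next
    case False
    then have "\<not> (i \<in> up_phases c \<union> down_phases c \<and> j \<in> up_phases c \<union> down_phases c)"
      by (auto simp: up_phases_def down_phases_def)
    with shape have "time_changed c A $ i $ j = 0" unfolding block_shape_def by blast
    then show ?thesis by simp
  qed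
qed

text \<open>
  A solution of the homogeneous equation is a fixed point of the Jacobian, so its absolute value is
  at most its image under it.
\<close>

lemma sylvester_kernel_trivial:
  fixes x :: "'s::finite \<times> 's \<Rightarrow> real"
  assumes d: "d \<noteq> 0"
    and P: "\<And>p q. 0 \<le> quad_slope (riccati_lin U D d T) (riccati_quad U D d T) x x p q"
    and w: "\<And>p. 0 < w p"
      "\<And>p. (\<Sum>q\<in>UNIV. quad_slope (riccati_lin U D d T) (riccati_quad U D d T) x x p q * w q) < w p"
    and Z: "Z \<in> block_shape U D"
      "(block U U T + as_matrix x ** block D U T) ** Z + Z ** (block D D T + block D U T ** as_matrix x) = 0"
  shows "Z = 0"
proof -
  define z where "z = (\<lambda>(i, j). Z $ i $ j)"
  have z: "as_matrix z = Z" by (simp add: z_def as_matrix_def vec_eq_iff)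
  have fix_z: "(\<Sum>q\<in>UNIV. quad_slope (riccati_lin U D d T) (riccati_quad U D d T) x x p q * z q) = z p" for p
  proof (cases p)
    case (Pair i j)
    show ?thesis
      unfolding Pair riccati_slope_sum z Z(2) using Z(1) by (auto simp: z_def block_shape_def)
  qed
  have "\<bar>z p\<bar> = 0" for p
  proof (rule subharmonic_eq_0[OF P w])
    fix p
    have "\<bar>z p\<bar> \<le> (\<Sum>q\<in>UNIV. \<bar>quad_slope (riccati_lin U D d T) (riccati_quad U D d T) x x p q * z q\<bar>)"
      by (subst fix_z[symmetric]) (rule sum_abs)
    then show "\<bar>z p\<bar> \<le> (\<Sum>q\<in>UNIV. quad_slope (riccati_lin U D d T) (riccati_quad U D d T) x x p q * \<bar>z q\<bar>)"
      by (simp add: abs_mult P)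
  qed simp
  then show ?thesis by (auto simp: z_def vec_eq_iff)
qed

lemma analytic_germ_time_changed:
  assumes "\<forall>\<^sub>F e in nhds 0. generator (A + e *\<^sub>R A') \<and> irreducible_matrix (A + e *\<^sub>R A')" "c \<noteq> 0"
  shows "analytic_germ (\<lambda>e. time_changed c (A + e *\<^sub>R A') $ i $ j)"
  using analytic_germ_mult[OF analytic_germ_fluid_Q[OF assms] analytic_germ_const[of "1 / \<bar>c $ i\<bar>"]]
  by (simp add: time_changed_def)

lemma analytic_germ_riccati_coefficients:
  assumes T: "\<And>i j. analytic_germ (\<lambda>e. T e $ i $ j)"
  shows "analytic_germ (\<lambda>e. riccati_const U D d (T e) p)"
    "analytic_germ (\<lambda>e. riccati_lin U D d (T e) p q)"
    "analytic_germ (\<lambda>e. riccati_quad U D d (T e) p q r)"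
proof -
  have if_germ: "analytic_germ (\<lambda>e. if b then u e else v e)" if "analytic_germ u" "analytic_germ v" for b u v
    using that by (cases b) simp_all
  have div: "analytic_germ (\<lambda>e. (if b then T e $ i $ j else 0) / d)" for b i j
    using analytic_germ_mult[OF if_germ[OF T analytic_germ_const] analytic_germ_const[of "1 / d"]] by simp
  obtain i j k l m n where [simp]: "p = (i, j)" "q = (k, l)" "r = (m, n)" by (metis surj_pair)
  show "analytic_germ (\<lambda>e. riccati_const U D d (T e) p)"
    "analytic_germ (\<lambda>e. riccati_lin U D d (T e) p q)"
    "analytic_germ (\<lambda>e. riccati_quad U D d (T e) p q r)"
    by (simp_all only: riccati_const_def riccati_lin_def riccati_quad_def block_nth prod.case
      \<open>p = (i, j)\<close> \<open>q = (k, l)\<close> \<open>r = (m, n)\<close>)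
       (intro if_germ analytic_germ_add analytic_germ_const div)+
qed

text \<open>
  The constant \<open>d\<close> exceeds twice every \<open>- T\<^sub>i\<^sub>i\<close> at \<open>\<epsilon> = 0\<close> strictly, so the same \<open>d\<close> serves for
  all \<open>\<epsilon>\<close> near \<open>0\<close>.
\<close>

lemma fluid_Psi_analytic:
  fixes A A' :: "real^'s^'s" and c \<xi> :: "real^'s"
  assumes gen: "\<forall>\<^sub>F e in nhds 0. generator (A + e *\<^sub>R A') \<and> irreducible_matrix (A + e *\<^sub>R A')"
    and stat: "stationary_distribution A \<xi>" and drift: "\<xi> \<bullet> c < 0"
  shows "analytic_germ (\<lambda>e. fluid_Psi c (A + e *\<^sub>R A') $ i $ j)"
    and "\<forall>\<^sub>F e in nhds 0. riccati_solution c (A + e *\<^sub>R A') (fluid_Psi c (A + e *\<^sub>R A'))"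
    and "Z \<in> block_shape (up_phases c) (down_phases c) \<Longrightarrow> fluid_K c A ** Z + Z ** fluid_U c A = 0 \<Longrightarrow> Z = 0"
proof -
  let ?U = "up_phases c" and ?D = "down_phases c"
  have c: "c \<noteq> 0" using drift by auto
  define T where "T e = time_changed c (A + e *\<^sub>R A')" for e
  have A: "generator A" "irreducible_matrix A" using eventually_nhds_x_imp_x[OF gen] by simp_all
  have T0: "time_changed c A = T 0" by (simp add: T_def)
  interpret T0: censored_flow ?U ?D "T 0"
    using censored_flow_time_changed[OF A c] by (simp add: T0)
  have germ: "analytic_germ (\<lambda>e. T e $ i $ j)" for i j
    unfolding T_def by (rule analytic_germ_time_changed[OF gen c])
  obtain X where X: "X \<in> block_shape ?U ?D" "0 \<le> X" and sub: "\<And>i. (X *v 1) $ i \<le> 1"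
    and sol: "riccati_residual ?U ?D (T 0) X = 0" by (rule T0.substochastic_riccati_solution) blast
  obtain h where h: "\<And>i. c $ i \<noteq> 0 \<Longrightarrow> sgn (c $ i) < (T 0 *v h) $ i"
    using time_changed_drift[OF A stat drift] unfolding T0 by blast
  have up: "1 < (T 0 *v h) $ i" if "i \<in> ?U" for i using h[of i] that by (simp add: up_phases_def)
  have down: "- 1 < (T 0 *v h) $ i" if "i \<in> ?D" for i using h[of i] that by (simp add: down_phases_def)
  obtain k where k: "\<And>i. i \<in> ?U \<Longrightarrow> 0 < k $ i" "\<And>i. i \<in> ?U \<Longrightarrow> (T0.K X *v k) $ i < 0"
    by (rule T0.K_stable[OF X sub sol up down]) blast+
  define d where "d = 2 * (\<Sum>i\<in>UNIV. \<bar>T 0 $ i $ i\<bar>) + 1"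
  have d0: "0 < d" by (simp add: d_def add_nonneg_pos sum_nonneg)
  have d: "- T 0 $ i $ i < d / 2" for i
    using member_le_sum[of i UNIV "\<lambda>i. \<bar>T 0 $ i $ i\<bar>"] by (simp add: d_def)
  have ev_d: "\<forall>\<^sub>F e in nhds 0. \<forall>i. - T e $ i $ i < d / 2"
    by (intro eventually_all_finite order_tendstoD(2)[OF tendsto_minus[OF analytic_germ_continuous[OF germ]] d])
  define a where "a e = riccati_const ?U ?D d (T e)" for e
  define b where "b e = riccati_lin ?U ?D d (T e)" for e
  define q where "q e = riccati_quad ?U ?D d (T e)" for e
  have nn: "\<forall>\<^sub>F e in nhds 0. (\<forall>p. 0 \<le> a e p) \<and> (\<forall>p r. 0 \<le> b e p r) \<and> (\<forall>p r s. 0 \<le> q e p r s)"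
    using gen ev_d
  proof eventually_elim
    case (elim e)
    interpret Te: censored_flow ?U ?D "T e"
      unfolding T_def using elim c by (intro censored_flow_time_changed) auto
    show ?case unfolding a_def b_def q_def
      using Te.riccati_coefficients_nonneg[OF d0 less_imp_le] elim(2) by blast
  qed
  define x where "x = (\<lambda>(i, j). X $ i $ j)"
  have x: "as_matrix x = X" by (simp add: x_def as_matrix_def vec_eq_iff)
  have x_nn: "0 \<le> x p" for p using X(2) by (auto simp: x_def less_eq_vec_def split: prod.split)
  have fix_x: "quad_map (a 0) (b 0) (q 0) x = x"
    unfolding a_def b_def q_def using d0 X(1) sol by (subst riccati_fixpoint_iff) (auto simp: x)
  obtain w where w: "\<And>p. 0 < w p" "\<And>p. (\<Sum>r\<in>UNIV. quad_slope (b 0) (q 0) x x p r * w r) < w p"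
  proof (rule T0.riccati_subcritical[OF X sub k d0 less_imp_le[OF d], folded x_def])
    fix w assume "\<And>p. 0 < w p" "\<And>p. (\<Sum>r\<in>UNIV. quad_slope (riccati_lin ?U ?D d (T 0)) (riccati_quad ?U ?D d (T 0)) x x p r * w r) < w p"
    then show thesis unfolding b_def[symmetric] q_def[symmetric] by (rule that)
  qed
  obtain g where g: "\<And>p. analytic_germ (\<lambda>e. g e p)" "g 0 = x"
    "\<forall>\<^sub>F e in nhds 0. least_fixpoint (a e) (b e) (q e) (g e)"
  proof (rule least_fixpoint_analytic[OF _ _ _ nn x_nn fix_x w])
    show "analytic_germ (\<lambda>e. a e p)" "analytic_germ (\<lambda>e. b e p r)" "analytic_germ (\<lambda>e. q e p r s)" for p r s
      unfolding a_def b_def q_def by (rule analytic_germ_riccati_coefficients[OF germ])+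
  qed blast
  have Psi: "\<forall>\<^sub>F e in nhds 0. fluid_Psi c (A + e *\<^sub>R A') = as_matrix (g e)
      \<and> riccati_solution c (A + e *\<^sub>R A') (fluid_Psi c (A + e *\<^sub>R A'))"
    using g(3)
  proof eventually_elim
    case (elim e)
    then show ?case
      using fluid_Psi_eq_least_fixpoint[of d c "A + e *\<^sub>R A'" "g e"] d0 by (simp add: a_def b_def q_def T_def)
  qed
  show "\<forall>\<^sub>F e in nhds 0. riccati_solution c (A + e *\<^sub>R A') (fluid_Psi c (A + e *\<^sub>R A'))"
    using Psi by eventually_elim (rule conjunct2)
  show "analytic_germ (\<lambda>e. fluid_Psi c (A + e *\<^sub>R A') $ i $ j)"
    by (rule analytic_germ_cong[OF g(1)[of "(i, j)"]])
       (use Psi in \<open>eventually_elim, simp add: as_matrix_def\<close>)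
  have Psi0: "fluid_Psi c A = X" using eventually_nhds_x_imp_x[OF Psi] by (simp add: g(2) x)
  show "Z = 0" if "Z \<in> block_shape ?U ?D" "fluid_K c A ** Z + Z ** fluid_U c A = 0"
  proof (rule sylvester_kernel_trivial[of d ?U ?D "T 0" x w])
    show "0 \<le> quad_slope (riccati_lin ?U ?D d (T 0)) (riccati_quad ?U ?D d (T 0)) x x p r" for p r
      by (intro quad_slope_nonneg T0.riccati_coefficients_nonneg d0 less_imp_le[OF d] x_nn)
    show "(block ?U ?U (T 0) + as_matrix x ** block ?D ?U (T 0)) ** Z
        + Z ** (block ?D ?D (T 0) + block ?D ?U (T 0) ** as_matrix x) = 0"
      using that(2) by (simp add: fluid_K_def fluid_U_def Psi0 x C_up_inv_mult_block abs_C_down_inv_mult_block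
          flip: T0 matrix_mul_assoc[of X "abs_C_down_inv c"])
  qed (use d0 w that(1) in \<open>simp_all add: b_def q_def\<close>)
qed

lemma bounded_linear_block: "bounded_linear (block I J :: real^'s^'s \<Rightarrow> real^'s^'s)"
  unfolding linear_conv_bounded_linear[symmetric] by (intro linearI) (auto simp: vec_eq_iff)

lemmas has_vector_derivative_block = bounded_linear.has_vector_derivative[OF bounded_linear_block]

lemmas has_vector_derivative_matrix_mult =
  bounded_bilinear.has_vector_derivative[OF bounded_bilinear_matrix_mult]

lemma has_vector_derivative_eventually_0:
  assumes "(f has_vector_derivative f') (at (x::real))" "\<forall>\<^sub>F y in nhds x. f y = 0"
  shows "f' = 0"
proof -
  have "((\<lambda>_. 0) has_vector_derivative f') (at x)"
    using assms(1) unfolding has_vector_derivative_def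
    by (rule has_derivative_transform_eventually)
       (use assms(2) eventually_nhds_x_imp_x[OF assms(2)] in \<open>auto simp: eventually_nhds_conv_at\<close>)
  then show ?thesis using vector_derivative_unique_at has_vector_derivative_const by metis
qed

theorem theorem2p1:
  fixes A A' :: "real^'s^'s" and c \<xi> :: "real^'s"
  defines "\<Psi> \<equiv> \<lambda>\<epsilon>. fluid_Psi c (A + \<epsilon> *\<^sub>R A')"
  defines "Q' \<equiv> fluid_Q_tilde c A A'"
  assumes "A' *v 1 = 0"
    and "\<forall>\<^sub>F \<epsilon> in nhds 0. generator (A + \<epsilon> *\<^sub>R A') \<and> irreducible_matrix (A + \<epsilon> *\<^sub>R A')"
    and "stationary_distribution A \<xi>"
    and "\<xi> \<bullet> (rate_matrix c *v 1) < 0"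
  shows "(\<forall>\<^sub>F \<epsilon> in nhds 0. real_analytic_at \<Psi> \<epsilon>) \<and>
    (\<exists>D. (\<Psi> has_vector_derivative D) (at 0) \<and>
      (\<forall>X. X \<in> block_shape (up_phases c) (down_phases c) \<and>
           fluid_K c A ** X + X ** fluid_U c A =
             - (C_up_inv c ** block_ud c Q')
             - C_up_inv c ** block_uu c Q' ** fluid_Psi c A
             - fluid_Psi c A ** abs_C_down_inv c ** block_dd c Q'
             - fluid_Psi c A ** abs_C_down_inv c ** block_du c Q' ** fluid_Psi c A
           \<longleftrightarrow> X = D))"
proof -
  let ?U = "up_phases c" and ?D = "down_phases c"
  let ?rhs = "- (C_up_inv c ** block_ud c Q')
             - C_up_inv c ** block_uu c Q' ** fluid_Psi c A
             - fluid_Psi c A ** abs_C_down_inv c ** block_dd c Q'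
             - fluid_Psi c A ** abs_C_down_inv c ** block_du c Q' ** fluid_Psi c A"
  have "(rate_matrix c *v 1) $ i = c $ i" for i
    by (simp add: matrix_vector_nth rate_matrix_def)
  then have "rate_matrix c *v 1 = c" by (simp add: vec_eq_iff)
  then have drift: "\<xi> \<bullet> c < 0" using assms by simp
  then have c: "c \<noteq> 0" by auto
  note gen = assms(4)
  note Psi = fluid_Psi_analytic[OF gen assms(5) drift]
  have germ: "analytic_germ (\<lambda>e. \<Psi> e $ i $ j)" for i j unfolding \<Psi>_def by (rule Psi(1))
  have \<Psi>0: "\<Psi> 0 = fluid_Psi c A" by (simp add: \<Psi>_def)
  obtain D where "(\<lambda>e. norm (\<Psi> e - \<Psi> 0 - e *\<^sub>R D)) \<in> O[at 0](\<lambda>e. e\<^sup>2)"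
    by (rule matrix_first_order_expansion[OF germ])
  then have D: "(\<Psi> has_vector_derivative D) (at 0)"
    by (rule first_order_expansion_imp_has_vector_derivative)
  define Q where "Q e = fluid_Q c (A + e *\<^sub>R A')" for e
  have Q0: "Q 0 = fluid_Q c A" by (simp add: Q_def)
  have "analytic_germ (\<lambda>e. Q e $ i $ j)" for i j
    unfolding Q_def by (rule analytic_germ_fluid_Q[OF gen c])
  then obtain D\<^sub>Q where expand: "(\<lambda>e. norm (Q e - Q 0 - e *\<^sub>R D\<^sub>Q)) \<in> O[at 0](\<lambda>e. e\<^sup>2)"
    by (rule matrix_first_order_expansion)
  then have "Q' = D\<^sub>Q" unfolding Q'_def by (intro fluid_Q_tilde_eqI) (simp add: Q_def)
  then have Q': "(Q has_vector_derivative Q') (at 0)"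
    using first_order_expansion_imp_has_vector_derivative[OF expand] by simp

  define F where "F e = C_up_inv c ** block_ud c (Q e) + C_up_inv c ** block_uu c (Q e) ** \<Psi> e
     + \<Psi> e ** abs_C_down_inv c ** block_dd c (Q e) + \<Psi> e ** abs_C_down_inv c ** block_du c (Q e) ** \<Psi> e" for e
  \<comment> \<open>the literal form of the product rule; the terms with \<open>0\<close> come from the constant factors\<close>
  have "(F has_vector_derivative
      C_up_inv c ** block_ud c Q' + 0 ** block_ud c (Q 0)
      + (C_up_inv c ** block_uu c (Q 0) ** D + (C_up_inv c ** block_uu c Q' + 0 ** block_uu c (Q 0)) ** \<Psi> 0)
      + (\<Psi> 0 ** abs_C_down_inv c ** block_dd c Q' + (\<Psi> 0 ** 0 + D ** abs_C_down_inv c) ** block_dd c (Q 0))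
      + (\<Psi> 0 ** abs_C_down_inv c ** block_du c (Q 0) ** D
         + (\<Psi> 0 ** abs_C_down_inv c ** block_du c Q' + (\<Psi> 0 ** 0 + D ** abs_C_down_inv c) ** block_du c (Q 0)) ** \<Psi> 0)) (at 0)"
    unfolding F_def
    by (intro has_vector_derivative_add has_vector_derivative_matrix_mult has_vector_derivative_block
        has_vector_derivative_const D Q')
  moreover have "\<forall>\<^sub>F e in nhds 0. F e = 0"
    using Psi(2) by eventually_elim (simp add: riccati_solution_def F_def \<Psi>_def Q_def)
  ultimately have "C_up_inv c ** block_ud c Q' + 0 ** block_ud c (Q 0)
      + (C_up_inv c ** block_uu c (Q 0) ** D + (C_up_inv c ** block_uu c Q' + 0 ** block_uu c (Q 0)) ** \<Psi> 0)
      + (\<Psi> 0 ** abs_C_down_inv c ** block_dd c Q' + (\<Psi> 0 ** 0 + D ** abs_C_down_inv c) ** block_dd c (Q 0))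
      + (\<Psi> 0 ** abs_C_down_inv c ** block_du c (Q 0) ** D
         + (\<Psi> 0 ** abs_C_down_inv c ** block_du c Q' + (\<Psi> 0 ** 0 + D ** abs_C_down_inv c) ** block_du c (Q 0)) ** \<Psi> 0) = 0" (is "?total = 0")
    by (rule has_vector_derivative_eventually_0)
  moreover have "fluid_K c A ** D + D ** fluid_U c A - ?rhs = ?total"
    unfolding fluid_K_def fluid_U_def \<Psi>0 Q0
    by (simp only: matrix_mult_simps matrix_mul_assoc) simp
  ultimately have D_eq: "fluid_K c A ** D + D ** fluid_U c A = ?rhs" by simp

  \<comment> \<open>the block shape is a closed linear condition, so it passes to the derivative\<close>
  have "block ?U ?D D - D = 0"
  proof (rule has_vector_derivative_eventually_0)
    show "((\<lambda>e. block ?U ?D (\<Psi> e) - \<Psi> e) has_vector_derivative block ?U ?D D - D) (at 0)"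
      by (intro has_vector_derivative_diff has_vector_derivative_block D)
    show "\<forall>\<^sub>F e in nhds 0. block ?U ?D (\<Psi> e) - \<Psi> e = 0"
      using Psi(2) by eventually_elim (auto simp: riccati_solution_def \<Psi>_def block_shape_def vec_eq_iff)
  qed
  then have D_block: "block ?U ?D D = D" by simp
  have "D $ i $ j = 0" if "\<not> (i \<in> ?U \<and> j \<in> ?D)" for i j
  proof -
    have "block ?U ?D D $ i $ j = 0" using that by auto
    then show ?thesis by (simp only: D_block)
  qed
  then have D_shape: "D \<in> block_shape ?U ?D"
    unfolding block_shape_def by blast

  have unique: "X = D" if X: "X \<in> block_shape ?U ?D" "fluid_K c A ** X + X ** fluid_U c A = ?rhs" for X
  proof -
    have shape: "X - D \<in> block_shape ?U ?D" using X(1) D_shape by (simp add: block_shape_def)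
    have "fluid_K c A ** (X - D) + (X - D) ** fluid_U c A
        = (fluid_K c A ** X + X ** fluid_U c A) - (fluid_K c A ** D + D ** fluid_U c A)"
      by (simp add: matrix_mult_simps)
    also have "\<dots> = 0" by (simp only: X(2) D_eq) simp
    finally show ?thesis using Psi(3)[OF shape] by simp
  qed
  show ?thesis
  proof (intro conjI exI[of _ D] allI iffI)
    show "\<forall>\<^sub>F \<epsilon> in nhds 0. real_analytic_at \<Psi> \<epsilon>" by (rule real_analytic_at_matrix[OF germ])
    show "(\<Psi> has_vector_derivative D) (at 0)" by (rule D)
  next
    fix X assume "X \<in> block_shape ?U ?D \<and> fluid_K c A ** X + X ** fluid_U c A = ?rhs"
    then show "X = D" by (elim conjE) (rule unique)
  next
    fix X assume X: "X = D"
    show "X \<in> block_shape ?U ?D" "fluid_K c A ** X + X ** fluid_U c A = ?rhs"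
      unfolding X by (rule D_shape, rule D_eq)
  qed
qed

end
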